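(* Let $p$ be an odd prime and let $P$ be an extraspecial group of order $p^3$ and exponent $p$. Then all fusion systems on $P$ are non-$p$-stable, except for the fusion systems $\mathcal{F}_P(G)$ of groups of the form $G=P\rtimes H$ with $H$ a finite group such that $p\nmid |H|$; these exceptional fusion systems are section $p$-stable.
   Context: All fusion systems are saturated fusion systems in the usual sense; maps are written on the right. For a finite group $G$ with Sylow $p$-subgroup $P$, $\mathcal{F}_P(G)$ is the fusion system on $P$ whose morphisms are the maps induced by conjugation in $G$. Let $\mathcal{F}$ be a fusion system on a finite $p$-group $P$. $Q\le P$ is fully $\mathcal{F}$-normalised if $|N_P(Q)|\ge |N_P(Q\phi)|$ for every $\mathcal{F}$-morphism $\phi$ with domain $Q$. For such $Q$, $\mathcal{N}_{\mathcal{F}}(Q)$ is the subsystem on $N_P(Q)$ whose morphisms $R\to T$ are the $\mathcal{F}$-morphisms extending to an $\mathcal{F}$-morphism $RQ\to TQ$ that restricts to an automorphism of $Q$. $Q$ is normal in $\mathcal{F}$ if $\mathcal{N}_{\mathcal{F}}(Q)=\mathcal{F}$; then $\mathcal{F}/Q$ is the fusion system on $P/Q$ whose morphisms $T/Q\to R/Q$ are those induced by $\mathcal{F}$-morphisms $T\to R$. $\mathcal{F}$ is $p$-stable if for every fully $\mathcal{F}$-normalised $Q\le P$, whenever $\chi\in\mathrm{Aut}_{\mathcal{F}}(Q)$ satisfies $(a^{-1})^{\chi}\, a\, (a^{-1})^{\chi}\, a^{\chi^2}=1$ for all $a\in Q$, then $\chi\in O_p(\mathrm{Aut}_{\mathcal{F}}(Q))$.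 $\mathcal{F}$ is section $p$-stable if $\mathcal{N}_{\mathcal{F}}(R)/R$ is $p$-stable for all fully $\mathcal{F}$-normalised $R\le P$. *)

theory Defs
  imports "HOL-Algebra.Group_Action" "HOL-Algebra.Sylow"
begin

section \<open>Group theory\<close>

definition centraliser :: "('a, 'b) monoid_scheme \<Rightarrow> 'a set \<Rightarrow> 'a set" where
  "centraliser G Q = {g \<in> carrier G. \<forall>x\<in>Q. g \<otimes>\<^bsub>G\<^esub> x = x \<otimes>\<^bsub>G\<^esub> g}"

abbreviation center :: "('a, 'b) monoid_scheme \<Rightarrow> 'a set" where
  "center G \<equiv> centraliser G (carrier G)"

definition finite_p_group :: "nat \<Rightarrow> ('a, 'b) monoid_scheme \<Rightarrow> bool" where
  "finite_p_group p G \<longleftrightarrow> group G \<and> finite (carrier G) \<and> (\<exists>n. order G = p ^ n)"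

definition elementary_abelian :: "nat \<Rightarrow> ('a, 'b) monoid_scheme \<Rightarrow> bool" where
  "elementary_abelian p G \<longleftrightarrow> comm_group G \<and> (\<forall>x\<in>carrier G. x [^]\<^bsub>G\<^esub> p = \<one>\<^bsub>G\<^esub>)"

definition extraspecial :: "nat \<Rightarrow> ('a, 'b) monoid_scheme \<Rightarrow> bool" where
  "extraspecial p G \<longleftrightarrow> finite_p_group p G \<and> card (center G) = p \<and>
     elementary_abelian p (G Mod center G) \<and> order (G Mod center G) \<noteq> 1"

definition group_exponent :: "('a, 'b) monoid_scheme \<Rightarrow> nat" where
  "group_exponent G = (LEAST n. 0 < n \<and> (\<forall>x\<in>carrier G. x [^]\<^bsub>G\<^esub> n = \<one>\<^bsub>G\<^esub>))"

definition sylow_subgroup :: "nat \<Rightarrow> ('a, 'b) monoid_scheme \<Rightarrow> 'a set \<Rightarrow> bool" where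
  "sylow_subgroup p G S \<longleftrightarrow> subgroup S G \<and> card S = p ^ multiplicity p (order G)"

text \<open>\<open>p_core p G\<close> is $O_p(G)$. In a finite group the product of two normal $p$-subgroups is again
  one, so the union below is itself the largest normal $p$-subgroup.\<close>

definition p_core :: "nat \<Rightarrow> ('a, 'b) monoid_scheme \<Rightarrow> 'a set" where
  "p_core p G = \<Union>{N. normal N G \<and> finite_p_group p (G\<lparr>carrier := N\<rparr>)}"

section \<open>Fusion systems\<close>

text \<open>A fusion system on \<open>P\<close> is a family \<open>F\<close> of hom-sets, \<open>F Q R\<close> being the set of morphisms from
  \<open>Q\<close> to \<open>R\<close>. Morphisms with domain \<open>Q\<close> are functions that are undefined outside \<open>Q\<close>
  (\<open>extensional Q\<close>). Only the values of \<open>F\<close> at subgroups of \<open>P\<close> are meaningful.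
  Conjugation is the right action $x^g = g^{-1} x g$.\<close>

type_synonym 'a fusion = "'a set \<Rightarrow> 'a set \<Rightarrow> ('a \<Rightarrow> 'a) set"

definition conj_by :: "('a, 'b) monoid_scheme \<Rightarrow> 'a \<Rightarrow> 'a \<Rightarrow> 'a" where
  "conj_by G g x = inv\<^bsub>G\<^esub> g \<otimes>\<^bsub>G\<^esub> x \<otimes>\<^bsub>G\<^esub> g"

text \<open>The maps \<open>Q \<rightarrow> R\<close> induced by conjugation in \<open>G\<close>. On the subgroups of a subgroup \<open>S\<close> of \<open>G\<close>
  this is $\mathcal{F}_S(G)$.\<close>

definition conj_fusion :: "('a, 'b) monoid_scheme \<Rightarrow> 'a fusion" where
  "conj_fusion G Q R = {restrict (conj_by G g) Q | g. g \<in> carrier G \<and> conj_by G g ` Q \<subseteq> R}"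

locale fusion_system = group P for P (structure) +
  fixes F :: "'a fusion"
  assumes injective_homs:
      "\<lbrakk>subgroup Q P; subgroup R P\<rbrakk> \<Longrightarrow>
         F Q R \<subseteq> mon (P\<lparr>carrier := Q\<rparr>) (P\<lparr>carrier := R\<rparr>) \<inter> extensional Q"
    and conj_morphisms:
      "\<lbrakk>subgroup Q P; subgroup R P\<rbrakk> \<Longrightarrow> conj_fusion P Q R \<subseteq> F Q R"
    and compose_morphisms:
      "\<lbrakk>subgroup Q P; subgroup R P; subgroup T P; \<phi> \<in> F Q R; \<psi> \<in> F R T\<rbrakk> \<Longrightarrow>
         compose Q \<psi> \<phi> \<in> F Q T"
    and iso_onto_image:
      "\<lbrakk>subgroup Q P; subgroup R P; \<phi> \<in> F Q R\<rbrakk> \<Longrightarrow>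
         \<phi> \<in> F Q (\<phi> ` Q) \<and> restrict (inv_into Q \<phi>) (\<phi> ` Q) \<in> F (\<phi> ` Q) Q"

definition fully_normalised :: "('a, 'b) monoid_scheme \<Rightarrow> 'a fusion \<Rightarrow> 'a set \<Rightarrow> bool" where
  "fully_normalised P F Q \<longleftrightarrow> subgroup Q P \<and>
     (\<forall>R \<phi>. subgroup R P \<longrightarrow> \<phi> \<in> F Q R \<longrightarrow> card (normalizer P (\<phi> ` Q)) \<le> card (normalizer P Q))"

definition fully_centralised :: "('a, 'b) monoid_scheme \<Rightarrow> 'a fusion \<Rightarrow> 'a set \<Rightarrow> bool" where
  "fully_centralised P F Q \<longleftrightarrow> subgroup Q P \<and>
     (\<forall>R \<phi>. subgroup R P \<longrightarrow> \<phi> \<in> F Q R \<longrightarrow> card (centraliser P (\<phi> ` Q)) \<le> card (centraliser P Q))"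

text \<open>\<open>BijGroup\<close> composes maps from right to left, so this is the opposite of the automorphism group
  with maps written on the right. The two have the same (normal, Sylow) subgroups.\<close>

definition Aut_grp :: "'a fusion \<Rightarrow> 'a set \<Rightarrow> ('a \<Rightarrow> 'a) monoid" where
  "Aut_grp F Q = (BijGroup Q)\<lparr>carrier := F Q Q\<rparr>"

text \<open>The subgroup $N_\phi$ of $N_P(Q)$ in the extension axiom.\<close>

definition extender :: "('a, 'b) monoid_scheme \<Rightarrow> 'a set \<Rightarrow> ('a \<Rightarrow> 'a) \<Rightarrow> 'a set" where
  "extender P Q \<phi> = {g \<in> normalizer P Q.
     \<exists>h\<in>normalizer P (\<phi> ` Q). \<forall>x\<in>Q. \<phi> (conj_by P g x) = conj_by P h (\<phi> x)}"

text \<open>Saturation in the sense of Broto, Levi and Oliver.\<close>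

locale saturated_fusion_system = fusion_system P F for P (structure) and F +
  fixes p :: nat
  assumes prime_p: "Factorial_Ring.prime p"
    and p_group: "finite_p_group p P"
    and sylow_axiom:
      "fully_normalised P F Q \<Longrightarrow> fully_centralised P F Q \<and>
         sylow_subgroup p (Aut_grp F Q) (conj_fusion P Q Q)"
    and extension_axiom:
      "\<lbrakk>subgroup Q P; \<phi> \<in> F Q (carrier P); fully_centralised P F (\<phi> ` Q)\<rbrakk> \<Longrightarrow>
         \<exists>\<psi>\<in>F (extender P Q \<phi>) (carrier P). \<forall>x\<in>Q. \<psi> x = \<phi> x"

text \<open>$\mathcal{N}_{\mathcal{F}}(Q)$, a fusion system on $N_P(Q)$.\<close>

definition normaliser_fusion :: "('a, 'b) monoid_scheme \<Rightarrow> 'a fusion \<Rightarrow> 'a set \<Rightarrow> 'a fusion" where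
  "normaliser_fusion P F Q R T = {\<phi> \<in> F R T.
     \<exists>\<psi>\<in>F (R <#>\<^bsub>P\<^esub> Q) (T <#>\<^bsub>P\<^esub> Q). \<psi> ` Q = Q \<and> (\<forall>x\<in>R. \<psi> x = \<phi> x)}"

text \<open>$\mathcal{F}/Q$, a fusion system on \<open>P Mod Q\<close>, for \<open>Q\<close> normal in \<open>F\<close>.\<close>

definition quotient_fusion :: "('a, 'b) monoid_scheme \<Rightarrow> 'a fusion \<Rightarrow> 'a set \<Rightarrow> 'a set fusion" where
  "quotient_fusion P F Q A B = {\<psi> \<in> A \<rightarrow>\<^sub>E B. \<exists>T R \<phi>.
     subgroup T P \<and> subgroup R P \<and> Q \<subseteq> T \<and> Q \<subseteq> R \<and>
     A = carrier (P\<lparr>carrier := T\<rparr> Mod Q) \<and> B = carrier (P\<lparr>carrier := R\<rparr> Mod Q) \<and>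
     \<phi> \<in> F T R \<and> (\<forall>x\<in>T. \<psi> (Q #>\<^bsub>P\<^esub> x) = Q #>\<^bsub>P\<^esub> \<phi> x)}"

definition p_stable :: "nat \<Rightarrow> ('a, 'b) monoid_scheme \<Rightarrow> 'a fusion \<Rightarrow> bool" where
  "p_stable p P F \<longleftrightarrow> (\<forall>Q \<chi>. fully_normalised P F Q \<longrightarrow> \<chi> \<in> F Q Q \<longrightarrow>
     (\<forall>a\<in>Q. \<chi> (inv\<^bsub>P\<^esub> a) \<otimes>\<^bsub>P\<^esub> a \<otimes>\<^bsub>P\<^esub> \<chi> (inv\<^bsub>P\<^esub> a) \<otimes>\<^bsub>P\<^esub> \<chi> (\<chi> a) = \<one>\<^bsub>P\<^esub>) \<longrightarrow>
     \<chi> \<in> p_core p (Aut_grp F Q))"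

text \<open>\<open>R\<close> is always normal in \<open>normaliser_fusion P F R\<close>, so the quotient makes sense.\<close>

definition section_p_stable :: "nat \<Rightarrow> ('a, 'b) monoid_scheme \<Rightarrow> 'a fusion \<Rightarrow> bool" where
  "section_p_stable p P F \<longleftrightarrow> (\<forall>R. fully_normalised P F R \<longrightarrow>
     (let N = P\<lparr>carrier := normalizer P R\<rparr>
      in p_stable p (N Mod R) (quotient_fusion N (normaliser_fusion P F R) R)))"

section \<open>Semidirect products\<close>

definition internal_semidirect :: "('a, 'b) monoid_scheme \<Rightarrow> 'a set \<Rightarrow> 'a set \<Rightarrow> bool" where
  "internal_semidirect G S H \<longleftrightarrow>
     normal S G \<and> subgroup H G \<and> S \<inter> H = {\<one>\<^bsub>G\<^esub>} \<and> S <#>\<^bsub>G\<^esub> H = carrier G"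

text \<open>\<open>F\<close> is $\mathcal{F}_P(G)$ for a finite group $G = P \rtimes H$ with $p \nmid |H|$, where \<open>P\<close> is
  identified with the normal subgroup \<open>S\<close> of \<open>G\<close> by means of the isomorphism \<open>\<iota>\<close>. As \<open>H\<close> is a
  $p'$-group, \<open>S\<close> is the Sylow $p$-subgroup of \<open>G\<close>.\<close>

definition realised_by ::
  "nat \<Rightarrow> ('a, 'b) monoid_scheme \<Rightarrow> 'a fusion \<Rightarrow>
   ('g, 'c) monoid_scheme \<Rightarrow> 'g set \<Rightarrow> 'g set \<Rightarrow> ('a \<Rightarrow> 'g) \<Rightarrow> bool" where
  "realised_by p P F G S H \<iota> \<longleftrightarrow>
     group G \<and> finite (carrier G) \<and> internal_semidirect G S H \<and> \<not> p dvd card H \<and>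
     \<iota> \<in> iso P (G\<lparr>carrier := S\<rparr>) \<and>
     (\<forall>Q R. subgroup Q P \<longrightarrow> subgroup R P \<longrightarrow>
        F Q R = {\<phi> \<in> Q \<rightarrow>\<^sub>E R. \<exists>\<psi>\<in>conj_fusion G (\<iota> ` Q) (\<iota> ` R). \<forall>x\<in>Q. \<iota> (\<phi> x) = \<psi> (\<iota> x)})"

text \<open>Every finite group is isomorphic to one whose elements are natural numbers, so nothing is lost
  by fixing the type of \<open>G\<close> here.\<close>

definition semidirect_fusion :: "nat \<Rightarrow> ('a, 'b) monoid_scheme \<Rightarrow> 'a fusion \<Rightarrow> bool" where
  "semidirect_fusion p P F \<longleftrightarrow> (\<exists>(G :: nat monoid) S H \<iota>. realised_by p P F G S H \<iota>)"

end

theory Submission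
  imports Defs "HOL-Algebra.Multiplicative_Group" "HOL-Algebra.Weak_Morphisms"
begin

text \<open>Let \<open>F\<close> be saturated and \<open>p\<close>-stable. Elements of \<open>P\<close> act quadratically on every
  normal subgroup \<open>Q\<close> since \<open>P\<close> has class two, so for \<open>|Q| = p\<^sup>2\<close> stability makes the Sylow
  subgroup \<open>Aut_P(Q)\<close> of \<open>Aut_F(Q)\<close> normal. The extension axiom then extends every morphism to
  \<open>P\<close>, first from subgroups of order \<open>p\<^sup>2\<close> and then from the smaller ones, whose centralisers
  have order at least \<open>p\<^sup>2\<close>. Since the inner automorphisms of \<open>P\<close> form an abelian normal Sylow
  subgroup of \<open>Aut_F(P)\<close>, they have a complement \<open>H\<close> there, and \<open>F\<close> is realised by \<open>P \<rtimes> H\<close>.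

  Conversely, in the fusion system of \<open>P \<rtimes> H\<close> every automorphism group, also of a section, is the
  image of a group whose normal \<open>p\<close>-subgroup has index prime to \<open>p\<close>, so its \<open>p\<close>-elements lie in
  \<open>O_p\<close>; and a quadratic automorphism is a \<open>p\<close>-element.\<close>

section \<open>Quadratic automorphisms\<close>

text \<open>The obstacle in the first direction is that the extension axiom needs a fully
  centralised image and reaches only as far as \<open>extender\<close>. For |Q| = p^2 every g in P
  lies in the extender of \<phi>: the map \<phi> c_g \<phi>^-1 is a p-element of the automorphism
  group of the image, hence is itself conjugation by an element of P. For |Q| at most p the order of
  the centraliser decides: it is p^3 for central and p^2 for noncentral subgroups. The one danger is
  a noncentral subgroup with central image, but then the image is fully centralised, so the morphism
  extends to an automorphism of P, and automorphisms preserve the centre. P is embedded in P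
  \<rtimes> H by translations because the conjugation action of P on itself kills the centre. In the
  converse, index prime to p is expressed by one exponent j coprime to p with all j-th powers in the
  normal p-subgroup, a condition that every stabiliser inherits with the same j. Conjugation is a
  right action while \<open>BijGroup\<close> composes from right to left, so inverses appear
  wherever conjugation becomes a homomorphism.\<close>

lemma (in group) mult_inv_cancel_left:
  assumes "x \<in> carrier G" "y \<in> carrier G"
  shows "x \<otimes> (inv x \<otimes> y) = y" "inv x \<otimes> (x \<otimes> y) = y"
  using assms by (simp_all add: m_assoc[symmetric])

text \<open>By Bezout, x is a product of integer powers of the two given elements of H. This takes
  the place of order arguments in a quotient group.\<close>

lemma (in group) mem_subgroup_if_coprime_powers:
  assumes H: "subgroup H G" and x: "x \<in> carrier G"
    and "x [^] (m::nat) \<in> H" "x [^] (n::nat) \<in> H" "coprime m n"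
  shows "x \<in> H"
proof -
  obtain u v where uv: "u * int m + v * int n = 1"
    using \<open>coprime m n\<close> bezout_int[of "int m" "int n"] by auto
  have pow: "y [^] (k::int) \<in> H" if "y \<in> H" for y k
    using subgroup.subgroup_is_group[OF H is_group] group.int_pow_closed[of "G\<lparr>carrier := H\<rparr>" y k]
      that int_pow_consistent[OF H that] by simp
  have "x = x [^] (int m * u + int n * v)"
    using uv x by (simp add: mult.commute)
  also have "\<dots> = (x [^] m) [^] u \<otimes> (x [^] n) [^] v"
    using x by (simp add: int_pow_mult int_pow_pow flip: int_pow_int)
  finally show ?thesis
    using pow assms(3,4) subgroup.m_closed[OF H] by metis
qed

lemma (in group) card_subgroup_dvd:
  assumes "subgroup H G" "subgroup K G" "H \<subseteq> K"
  shows "card H dvd card K"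
proof -
  have "card (rcosets\<^bsub>G\<lparr>carrier := K\<rparr>\<^esub> H) * card H = card K"
    using group.lagrange[OF subgroup_imp_group[OF assms(2)] subgroup_incl[OF assms]]
    by (simp add: order_def)
  then show ?thesis by (metis dvd_triv_right)
qed

lemma (in normal) pow_order_Mod_mem:
  assumes fin: "finite (carrier G)" and x: "x \<in> carrier G"
  shows "x [^] order (G Mod H) \<in> H"
proof -
  interpret Mod: group "G Mod H" by (rule factorgroup_is_group)
  have "(H #> x) [^]\<^bsub>G Mod H\<^esub> order (G Mod H) = H"
    using Mod.pow_order_eq_1[of "H #> x"] x fin by (auto simp: carrier_FactGroup)
  then have "H #> (x [^] order (G Mod H)) = H"
    using FactGroup_pow[OF x] by metis
  then show ?thesis
    using rcos_self[OF nat_pow_closed[OF x] is_subgroup] by metis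
qed

text \<open>The first isomorphism theorem needs a surjection, so the codomain is shrunk to the image
  before Lagrange is applied to the kernel.\<close>

lemma (in group_hom) card_image_kernel:
  "card (h ` carrier G) * card (kernel G H h) = order G"
proof -
  have "group_hom G (H\<lparr>carrier := h ` carrier G\<rparr>) h"
    using img_is_subgroup H.subgroup_imp_group G.is_group homh
    by (auto simp: group_hom_def group_hom_axioms_def hom_def)
  then interpret h: group_hom G "H\<lparr>carrier := h ` carrier G\<rparr>" h .
  have "kernel G (H\<lparr>carrier := h ` carrier G\<rparr>) h = kernel G H h"
    by (simp add: kernel_def)
  then have "card (rcosets\<^bsub>G\<^esub> kernel G H h) = card (h ` carrier G)"
    using iso_same_card[OF is_isoI[OF h.FactGroup_iso_set]] by (simp add: FactGroup_def)
  then show ?thesis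
    using G.lagrange[OF subgroup_kernel] by simp
qed

lemma (in group_hom) card_subgroup_image_dvd:
  assumes "subgroup K G"
  shows "card (h ` K) dvd card K"
proof -
  interpret K: group_hom "G\<lparr>carrier := K\<rparr>" H h
    using G.subgroup_imp_group[OF assms] homh subgroup.subset[OF assms]
    by (auto simp: group_hom_def group_hom_axioms_def hom_def subset_iff)
  show ?thesis
    using K.card_image_kernel by (simp add: order_def dvdI[OF sym])
qed

text \<open>Both the \<open>j\<close>-th and the \<open>p\<^sup>k\<close>-th power of \<open>h m\<close> lie in the normal \<open>p\<close>-subgroup \<open>h ` K\<close>,
  and the exponents are coprime.\<close>

lemma (in group_hom) mem_p_core_image:
  assumes p: "Factorial_Ring.prime p"
    and K: "K \<lhd> G" "finite K" "card K dvd p ^ n"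
    and m: "m \<in> carrier G" "m [^] (j::nat) \<in> K" "coprime j p" "h m [^]\<^bsub>H\<^esub> (p ^ k) = \<one>\<^bsub>H\<^esub>"
  shows "h m \<in> p_core p (H\<lparr>carrier := h ` carrier G\<rparr>)"
proof -
  let ?A = "H\<lparr>carrier := h ` carrier G\<rparr>"
  have sK: "subgroup K G"
    using K normal_imp_subgroup by blast
  have sH: "subgroup (h ` K) H"
    using subgroup_img_is_subgroup[OF sK] .
  have "h m [^]\<^bsub>H\<^esub> j \<in> h ` K"
    using m hom_nat_pow[of m j] by (metis imageI)
  moreover have "h m [^]\<^bsub>H\<^esub> (p ^ k) \<in> h ` K"
    using m subgroup.one_closed[OF sH] by simp
  ultimately have "h m \<in> h ` K"
    using H.mem_subgroup_if_coprime_powers[OF sH, of "h m" j "p ^ k"] m by simp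
  moreover have "h ` K \<lhd> ?A"
  proof -
    have "group_hom G ?A h"
      using img_is_subgroup H.subgroup_imp_group G.is_group homh
      by (auto simp: group_hom_def group_hom_axioms_def hom_def)
    then show ?thesis
      using normal.surj_hom_normal_subgroup[OF K(1), of ?A h] by simp
  qed
  moreover have "finite_p_group p (?A\<lparr>carrier := h ` K\<rparr>)"
  proof -
    have "card (h ` K) dvd p ^ n"
      using card_subgroup_image_dvd[OF sK] K dvd_trans by blast
    then have "\<exists>i. card (h ` K) = p ^ i"
      using divides_primepow_nat[OF p] by auto
    then show ?thesis
      using H.subgroup_imp_group[OF sH] K by (simp add: finite_p_group_def order_def)
  qed
  ultimately show ?thesis
    unfolding p_core_def by blast
qed

text \<open>The identity in the definition of \<open>p\<close>-stability says that \<open>c = a\<inverse> \<chi>(a)\<close> is fixed by \<open>\<chi>\<close>,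
  so that \<open>\<chi>\<^sup>n(a) = a c\<^sup>n\<close>.\<close>

lemma (in group) quadratic_pow_eq_one:
  assumes Q: "subgroup Q G" "finite Q"
    and \<chi>: "\<chi> \<in> hom (G\<lparr>carrier := Q\<rparr>) (G\<lparr>carrier := Q\<rparr>)" "\<chi> \<in> Bij Q"
    and quadratic: "\<And>a. a \<in> Q \<Longrightarrow> \<chi> (inv a) \<otimes> a \<otimes> \<chi> (inv a) \<otimes> \<chi> (\<chi> a) = \<one>"
  shows "\<chi> [^]\<^bsub>BijGroup Q\<^esub> card Q = \<one>\<^bsub>BijGroup Q\<^esub>"
proof -
  interpret B: group "BijGroup Q" by (rule group_BijGroup)
  interpret Q: group "G\<lparr>carrier := Q\<rparr>"
    by (rule subgroup_imp_group[OF Q(1)])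
  interpret h: group_hom "G\<lparr>carrier := Q\<rparr>" "G\<lparr>carrier := Q\<rparr>" \<chi>
    by (simp add: group_hom_def group_hom_axioms_def Q.is_group \<chi>)
  have sub: "x \<in> carrier G" if "x \<in> Q" for x
    using that by (rule subgroup.mem_carrier[OF Q(1)])
  have \<chi>_carrier: "\<chi> \<in> carrier (BijGroup Q)"
    using \<chi> by (simp add: BijGroup_def)
  have \<chi>Q: "\<chi> x \<in> Q" if "x \<in> Q" for x
    using h.hom_closed that by simp
  have \<chi>mult: "\<chi> (x \<otimes> y) = \<chi> x \<otimes> \<chi> y" if "x \<in> Q" "y \<in> Q" for x y
    using h.hom_mult that by simp
  have Qm: "x \<otimes> y \<in> Q" if "x \<in> Q" "y \<in> Q" for x y
    using Q.m_closed that by simp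
  have Qi: "inv x \<in> Q" if "x \<in> Q" for x
    using that by (rule subgroup.m_inv_closed[OF Q(1)])
  have Qp: "x [^] (n::nat) \<in> Q" if "x \<in> Q" for x n
    using Q.nat_pow_closed[of x n] that by (simp add: nat_pow_consistent[symmetric])
  have \<chi>inv: "\<chi> (inv x) = inv (\<chi> x)" if "x \<in> Q" for x
    using h.hom_inv[of x] that Q \<chi>Q by (simp add: m_inv_consistent)
  have iter: "(\<chi> [^]\<^bsub>BijGroup Q\<^esub> n) a = a \<otimes> (inv a \<otimes> \<chi> a) [^] n" if a: "a \<in> Q" for a and n :: nat
  proof -
    define c where "c = inv a \<otimes> \<chi> a"
    have cQ: "c \<in> Q" unfolding c_def by (intro Qm Qi \<chi>Q a)
    have ac: "\<chi> a = a \<otimes> c"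
      unfolding c_def using a \<chi>Q sub by (simp add: m_assoc[symmetric])
    \<comment> \<open>Grouped in pairs, the quadratic word is \<open>inv c\<close> times \<chi> c:
      its first two factors multiply to \<open>inv c\<close> and the outer two of the inverse and
      double image to \<chi> c.\<close>
    have "inv (\<chi> c) \<otimes> c = \<one>" if "inv (\<chi> a) \<otimes> a \<otimes> inv (\<chi> a) \<otimes> \<chi> (\<chi> a) = \<one>"
    proof -
      have "inv (\<chi> a) \<otimes> a = inv c"
        unfolding c_def using a \<chi>Q sub by (simp add: inv_mult_group)
      moreover have "inv (\<chi> a) \<otimes> \<chi> (\<chi> a) = \<chi> c"
        unfolding c_def using a \<chi>Q Qi \<chi>mult \<chi>inv by simp
      ultimately have "inv c \<otimes> \<chi> c = \<one>"
        using that a \<chi>Q sub cQ by (simp add: m_assoc)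
      then have "\<chi> c = c"
        using cQ \<chi>Q sub by (metis inv_closed inv_equality inv_inv inv_comm)
      then show ?thesis
        using cQ \<chi>Q sub by simp
    qed
    then have "inv (\<chi> c) \<otimes> c = \<one>"
      using quadratic[OF a] \<chi>inv[OF a] by simp
    then have \<chi>c: "\<chi> c = c"
      using cQ \<chi>Q sub by (metis inv_closed inv_equality inv_inv inv_comm)
    have "(\<chi> [^]\<^bsub>BijGroup Q\<^esub> n) a = a \<otimes> c [^] n"
    proof (induction n)
      case 0
      then show ?case using a sub by (simp add: BijGroup_def)
    next
      case (Suc n)
      have "(\<chi> [^]\<^bsub>BijGroup Q\<^esub> Suc n) a = (\<chi> \<otimes>\<^bsub>BijGroup Q\<^esub> (\<chi> [^]\<^bsub>BijGroup Q\<^esub> n)) a"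
        using B.nat_pow_Suc2[OF \<chi>_carrier] by simp
      also have "\<dots> = \<chi> ((\<chi> [^]\<^bsub>BijGroup Q\<^esub> n) a)"
        using a \<chi> B.nat_pow_closed[OF \<chi>_carrier, of n] by (simp add: BijGroup_def compose_def)
      also have "\<dots> = \<chi> a \<otimes> \<chi> (c [^] n)"
        using Suc \<chi>mult a Qp[OF cQ] by simp
      also have "\<chi> (c [^] n) = c [^] n"
        using h.hom_nat_pow[of c n] \<chi>c cQ by (simp add: nat_pow_consistent[symmetric])
      finally show ?case
        using ac cQ a sub nat_pow_Suc2[of c n] by (simp add: m_assoc)
    qed
    then show ?thesis by (simp add: c_def)
  qed
  have "(\<chi> [^]\<^bsub>BijGroup Q\<^esub> card Q) a = a" if a: "a \<in> Q" for a
  proof -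
    have "inv a \<otimes> \<chi> a \<in> Q"
      by (intro Qm Qi \<chi>Q a)
    then have "(inv a \<otimes> \<chi> a) [^] card Q = \<one>"
      using Q.pow_order_eq_1[of "inv a \<otimes> \<chi> a"] Q by (simp add: order_def nat_pow_consistent[symmetric])
    then show ?thesis
      using iter[OF a] a sub by simp
  qed
  moreover have "\<chi> [^]\<^bsub>BijGroup Q\<^esub> card Q \<in> extensional Q"
  proof -
    have "carrier (BijGroup Q) = Bij Q" by (simp add: BijGroup_def)
    then show ?thesis
      using B.nat_pow_closed[OF \<chi>_carrier, of "card Q"] Bij_imp_extensional by metis
  qed
  moreover have "\<one>\<^bsub>BijGroup Q\<^esub> = (\<lambda>x\<in>Q. x)" by (simp add: BijGroup_def)
  ultimately show ?thesis
    using extensionalityI[of _ Q "\<lambda>x\<in>Q. x"] by (metis restrict_extensional restrict_apply')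
qed

text \<open>A quadratic \<chi> has order dividing |Q|, a power of p. It lifts to some m in
  \<open>M Q\<close> whose j-th power lies in the normal p-subgroup \<open>K Q\<close>, and j is
  coprime to p, so \<chi> lies in the image of \<open>K Q\<close>. The action \<theta> is kept
  abstract because the criterion is applied twice: to subgroups of P, and to sets of cosets in a
  section.\<close>

lemma p_stable_if_Aut_image:
  fixes M :: "'a set \<Rightarrow> ('g, 'c) monoid_scheme"
  assumes p: "Factorial_Ring.prime p" and P: "finite_p_group p P"
    and hom: "\<And>Q. subgroup Q P \<Longrightarrow> group_hom (M Q) (BijGroup Q) (\<theta> Q)"
    and Aut: "\<And>Q. subgroup Q P \<Longrightarrow> F Q Q = \<theta> Q ` carrier (M Q)"
    and Aut_hom: "\<And>Q \<chi>. subgroup Q P \<Longrightarrow> \<chi> \<in> F Q Q \<Longrightarrow>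
      \<chi> \<in> hom (P\<lparr>carrier := Q\<rparr>) (P\<lparr>carrier := Q\<rparr>)"
    and K: "\<And>Q. subgroup Q P \<Longrightarrow> K Q \<lhd> M Q" "\<And>Q. subgroup Q P \<Longrightarrow> finite (K Q)"
      "\<And>Q. subgroup Q P \<Longrightarrow> card (K Q) dvd p ^ n"
    and j: "\<And>Q m. subgroup Q P \<Longrightarrow> m \<in> carrier (M Q) \<Longrightarrow> m [^]\<^bsub>M Q\<^esub> (j::nat) \<in> K Q" "coprime j p"
  shows "p_stable p P F"
  unfolding p_stable_def
proof (intro allI impI)
  fix Q \<chi>
  assume "fully_normalised P F Q" and \<chi>: "\<chi> \<in> F Q Q" and quadratic:
    "\<forall>a\<in>Q. \<chi> (inv\<^bsub>P\<^esub> a) \<otimes>\<^bsub>P\<^esub> a \<otimes>\<^bsub>P\<^esub> \<chi> (inv\<^bsub>P\<^esub> a) \<otimes>\<^bsub>P\<^esub> \<chi> (\<chi> a) = \<one>\<^bsub>P\<^esub>"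
  then have Q: "subgroup Q P" by (simp add: fully_normalised_def)
  interpret P: group P using P by (simp add: finite_p_group_def)
  interpret group_hom "M Q" "BijGroup Q" "\<theta> Q" using hom[OF Q] .
  have finP: "finite (carrier P)" using P by (simp add: finite_p_group_def)
  then have finQ: "finite Q" using subgroup.subset[OF Q] finite_subset by blast
  obtain m where m: "m \<in> carrier (M Q)" "\<chi> = \<theta> Q m" using \<chi> Aut[OF Q] by auto
  have "card Q dvd order P" using P.lagrange[OF Q] by (metis dvd_triv_right)
  then obtain k where k: "card Q = p ^ k"
    using P divides_primepow_nat[OF p] by (auto simp: finite_p_group_def)
  have "\<chi> \<in> Bij Q" using m hom_closed by (simp add: BijGroup_def)
  then have "\<chi> [^]\<^bsub>BijGroup Q\<^esub> (p ^ k) = \<one>\<^bsub>BijGroup Q\<^esub>"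
    using P.quadratic_pow_eq_one[OF Q finQ Aut_hom[OF Q \<chi>]] quadratic k by simp
  then show "\<chi> \<in> p_core p (Aut_grp F Q)"
    using mem_p_core_image[OF p K(1)[OF Q] K(2)[OF Q] K(3)[OF Q] m(1) j(1)[OF Q m(1)] j(2)]
    by (simp add: Aut_grp_def Aut[OF Q] m)
qed

section \<open>Fusion systems of group actions\<close>

lemma (in group) conj_by_closed [simp]:
  "\<lbrakk>g \<in> carrier G; x \<in> carrier G\<rbrakk> \<Longrightarrow> conj_by G g x \<in> carrier G"
  by (simp add: conj_by_def)

lemma (in group) conj_by_mult:
  "\<lbrakk>g \<in> carrier G; x \<in> carrier G; y \<in> carrier G\<rbrakk> \<Longrightarrow>
    conj_by G g (x \<otimes> y) = conj_by G g x \<otimes> conj_by G g y"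
  by (simp add: conj_by_def m_assoc) (simp add: r_inv m_assoc[symmetric])

lemma (in group) conj_by_conj_by:
  "\<lbrakk>g \<in> carrier G; h \<in> carrier G; x \<in> carrier G\<rbrakk> \<Longrightarrow>
    conj_by G g (conj_by G h x) = conj_by G (h \<otimes> g) x"
  by (simp add: conj_by_def m_assoc inv_mult_group)

lemma (in group) conj_by_one [simp]: "x \<in> carrier G \<Longrightarrow> conj_by G \<one> x = x"
  by (simp add: conj_by_def)

text \<open>The library's normaliser is the stabiliser under conjugation g H g^-1, whereas
  \<open>conj_by\<close> uses g^-1 H g. The two conditions agree because conjugations by g and by
  \<open>inv g\<close> undo each other.\<close>

lemma (in group) mem_normalizer_iff:
  assumes "H \<subseteq> carrier G"
  shows "g \<in> normalizer G H \<longleftrightarrow> g \<in> carrier G \<and> conj_by G g ` H = H"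
proof -
  have "g <# H #> inv g = conj_by G (inv g) ` H" if "g \<in> carrier G" for g
    using that by (auto simp: l_coset_def r_coset_def conj_by_def)
  moreover have "conj_by G (inv g) ` H = H \<longleftrightarrow> conj_by G g ` H = H" if g: "g \<in> carrier G" for g
  proof -
    have a: "conj_by G g ` conj_by G (inv g) ` H = H"
      using g assms by (force simp: image_image conj_by_conj_by subset_iff)
    have b: "conj_by G (inv g) ` conj_by G g ` H = H"
      using g assms by (force simp: image_image conj_by_conj_by subset_iff)
    show ?thesis using a b by metis
  qed
  ultimately show ?thesis
    using assms unfolding normalizer_def stabilizer_def by simp metis
qed

lemma (in group) normal_in_normalizer:
  assumes H: "subgroup H G"
  shows "H \<lhd> (G\<lparr>carrier := normalizer G H\<rparr>)"
proof -
  have sub: "H \<subseteq> carrier G" using subgroup.subset[OF H] .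
  have N: "subgroup (normalizer G H) G" using normalizer_imp_subgroup[OF sub] .
  interpret N: group "G\<lparr>carrier := normalizer G H\<rparr>" using subgroup_imp_group[OF N] .
  have "conj_by G h ` H = H" if "h \<in> H" for h
  proof
    show "conj_by G h ` H \<subseteq> H"
      using that H by (auto simp: conj_by_def subgroup.m_closed subgroup.m_inv_closed)
    have "x = conj_by G h (conj_by G (inv h) x)" "conj_by G (inv h) x \<in> H" if "x \<in> H" for x
      using that \<open>h \<in> H\<close> H sub
      by (auto simp: conj_by_conj_by subset_iff) (simp add: conj_by_def subgroup.m_closed subgroup.m_inv_closed)
    then show "H \<subseteq> conj_by G h ` H" by blast
  qed
  then have "H \<subseteq> normalizer G H"
    using mem_normalizer_iff[OF sub] sub by blast
  then have "subgroup H (G\<lparr>carrier := normalizer G H\<rparr>)"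
    using subgroup_incl[OF H N] by simp
  moreover have "x \<otimes> h \<otimes> inv x \<in> H" if x: "x \<in> normalizer G H" and h: "h \<in> H" for x h
  proof -
    have "inv x \<in> normalizer G H" using subgroup.m_inv_closed[OF N x] .
    then have "conj_by G (inv x) h \<in> H" using mem_normalizer_iff[OF sub] h by blast
    then show ?thesis using subgroup.mem_carrier[OF N x] by (simp add: conj_by_def)
  qed
  ultimately show ?thesis
    using N.normal_inv_iff[of H] N by simp
qed

text \<open>The set E need not lie in the group, which lets the same lemma turn into homomorphisms
  the actions on subgroups, on sets of cosets, and by conjugation with inverses.\<close>

lemma (in group) action_hom_BijGroup:
  assumes M: "subgroup M G"
    and closed: "\<And>m x. m \<in> M \<Longrightarrow> x \<in> E \<Longrightarrow> a m x \<in> E"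
    and one: "\<And>x. x \<in> E \<Longrightarrow> a \<one> x = x"
    and mult: "\<And>m n x. m \<in> M \<Longrightarrow> n \<in> M \<Longrightarrow> x \<in> E \<Longrightarrow> a (m \<otimes> n) x = a m (a n x)"
  shows "group_hom (G\<lparr>carrier := M\<rparr>) (BijGroup E) (\<lambda>m. restrict (a m) E)"
proof -
  have bij: "restrict (a m) E \<in> Bij E" if m: "m \<in> M" for m
  proof -
    have mi: "inv m \<in> M" using subgroup.m_inv_closed[OF M m] .
    have "a (inv m) (a m x) = x" "a m (a (inv m) x) = x" if "x \<in> E" for x
      using mult[OF m mi that] mult[OF mi m that] one[OF that] subgroup.mem_carrier[OF M m] by simp_all
    then have "bij_betw (a m) E E"
      using closed m mi by (intro bij_betwI[where g = "a (inv m)"]) auto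
    then show ?thesis by (simp add: Bij_def)
  qed
  then show ?thesis
    using subgroup_imp_group[OF M] group_BijGroup[of E] closed
    by (auto simp: group_hom_def group_hom_axioms_def hom_def BijGroup_def compose_def mult
        intro!: restrict_ext)
qed

text \<open>The realising group G is seen only through its action f on P by automorphisms, so G may
  have its own element type and the identification of P with a subgroup of G is dealt with once, in
  the interpretation. The action is on the left to match \<open>BijGroup\<close>.\<close>

locale fusion_of_action = group P + G: group G for P :: "('a, 'b) monoid_scheme" (structure)
    and G :: "('g, 'c) monoid_scheme" +
  fixes F :: "'a fusion" and f :: "'g \<Rightarrow> 'a \<Rightarrow> 'a"
  assumes f_hom: "m \<in> carrier G \<Longrightarrow> f m \<in> hom P P"
    and f_one: "x \<in> carrier P \<Longrightarrow> f \<one>\<^bsub>G\<^esub> x = x"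
    and f_mult: "\<lbrakk>m \<in> carrier G; n \<in> carrier G; x \<in> carrier P\<rbrakk> \<Longrightarrow> f (m \<otimes>\<^bsub>G\<^esub> n) x = f m (f n x)"
    and F_eq: "\<lbrakk>subgroup Q P; subgroup R P\<rbrakk> \<Longrightarrow>
      F Q R = {restrict (f m) Q | m. m \<in> carrier G \<and> f m ` Q \<subseteq> R}"
begin

lemma f_closed [simp]: "\<lbrakk>m \<in> carrier G; x \<in> carrier P\<rbrakk> \<Longrightarrow> f m x \<in> carrier P"
  using f_hom hom_in_carrier by metis

lemma f_inv: "\<lbrakk>m \<in> carrier G; x \<in> carrier P\<rbrakk> \<Longrightarrow> f (inv\<^bsub>G\<^esub> m) (f m x) = x"
  using f_mult[of "inv\<^bsub>G\<^esub> m" m x] f_one by simp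

lemma f_inj: "m \<in> carrier G \<Longrightarrow> inj_on (f m) (carrier P)"
  using f_inv by (metis inj_on_inverseI)

lemma f_image_eq:
  assumes "m \<in> carrier G" "Q \<subseteq> carrier P" "finite Q" "f m ` Q \<subseteq> Q"
  shows "f m ` Q = Q"
  using assms f_inj inj_on_subset endo_inj_surj by metis

text \<open>A family of sets is allowed because two instances occur: the family of Q alone, for the
  automorphisms of Q, and the pair T, R, for the automorphisms induced on the section T/R.\<close>

definition setwise_stab :: "'a set set \<Rightarrow> 'g set" where
  "setwise_stab \<X> = {m \<in> carrier G. \<forall>X\<in>\<X>. f m ` X = X}"

lemma subgroup_setwise_stab:
  assumes "\<And>X. X \<in> \<X> \<Longrightarrow> X \<subseteq> carrier P"
  shows "subgroup (setwise_stab \<X>) G"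
proof
  show "setwise_stab \<X> \<subseteq> carrier G" by (auto simp: setwise_stab_def)
  show "\<one>\<^bsub>G\<^esub> \<in> setwise_stab \<X>"
  proof -
    have "f \<one>\<^bsub>G\<^esub> ` X = X" if "X \<in> \<X>" for X
      using assms[OF that] f_one by (force simp: subset_iff)
    then show ?thesis by (simp add: setwise_stab_def)
  qed
next
  fix m n assume mn: "m \<in> setwise_stab \<X>" "n \<in> setwise_stab \<X>"
  have "f (m \<otimes>\<^bsub>G\<^esub> n) ` X = f m ` f n ` X" if "X \<in> \<X>" for X
    unfolding image_image using mn assms[OF that] f_mult
    by (intro image_cong) (auto simp: setwise_stab_def)
  then show "m \<otimes>\<^bsub>G\<^esub> n \<in> setwise_stab \<X>" using mn by (simp add: setwise_stab_def)
next
  fix m assume m: "m \<in> setwise_stab \<X>"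
  have "f (inv\<^bsub>G\<^esub> m) ` X = X" if "X \<in> \<X>" for X
  proof -
    have "f (inv\<^bsub>G\<^esub> m) ` f m ` X = X"
      using m assms[OF that] f_inv by (force simp: image_image setwise_stab_def subset_iff)
    then show ?thesis using m that by (simp add: setwise_stab_def)
  qed
  then show "inv\<^bsub>G\<^esub> m \<in> setwise_stab \<X>" using m by (simp add: setwise_stab_def)
qed

lemma setwise_stab_carrier: "m \<in> setwise_stab \<X> \<Longrightarrow> m \<in> carrier G"
  by (simp add: setwise_stab_def)

lemma setwise_stab_image: "\<lbrakk>m \<in> setwise_stab \<X>; X \<in> \<X>\<rbrakk> \<Longrightarrow> f m ` X = X"
  by (simp add: setwise_stab_def)

end

text \<open>In the application S is the copy of P inside G and j is the order of the complement.
  Writing p'-index as a condition on j-th powers avoids computing indices in stabilisers.\<close>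

locale fusion_of_p_closed_action = fusion_of_action +
  fixes p n j :: nat and S
  assumes prime_p: "Factorial_Ring.prime p"
    and p_group: "finite_p_group p P"
    and S_normal: "S \<lhd> G" and S_finite: "finite S" and S_card: "card S dvd p ^ n"
    and pow_mem_S: "m \<in> carrier G \<Longrightarrow> m [^]\<^bsub>G\<^esub> j \<in> S" and coprime_j: "coprime j p"
begin

lemma finite_subset_P: "Q \<subseteq> carrier P \<Longrightarrow> finite Q"
  using p_group finite_subset by (auto simp: finite_p_group_def)

text \<open>All conditions on S pass to its intersection with a subgroup M, with n and j unchanged.
  The criterion can therefore be used with one n and one j for all stabilisers.\<close>

lemma S_Int:
  assumes "subgroup M G"
  shows "S \<inter> M \<lhd> G\<lparr>carrier := M\<rparr>" "finite (S \<inter> M)" "card (S \<inter> M) dvd p ^ n"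
    "m \<in> M \<Longrightarrow> m [^]\<^bsub>G\<lparr>carrier := M\<rparr>\<^esub> j \<in> S \<inter> M"
proof -
  show "S \<inter> M \<lhd> G\<lparr>carrier := M\<rparr>" using G.normal_Int_subgroup[OF assms S_normal] .
  show "finite (S \<inter> M)" using S_finite by blast
  have S: "subgroup S G" using S_normal normal_imp_subgroup by blast
  have "card (S \<inter> M) dvd card S"
    using G.card_subgroup_dvd[OF G.subgroups_Inter_pair[OF S assms] S] by blast
  then show "card (S \<inter> M) dvd p ^ n" using S_card dvd_trans by blast
  show "m [^]\<^bsub>G\<lparr>carrier := M\<rparr>\<^esub> j \<in> S \<inter> M" if "m \<in> M"
  proof -
    interpret M: group "G\<lparr>carrier := M\<rparr>" by (rule G.subgroup_imp_group[OF assms])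
    have "m [^]\<^bsub>G\<lparr>carrier := M\<rparr>\<^esub> j \<in> M" using M.nat_pow_closed[of m j] that by simp
    moreover have "m [^]\<^bsub>G\<lparr>carrier := M\<rparr>\<^esub> j \<in> S"
      using pow_mem_S[of m] subgroup.mem_carrier[OF assms that] G.nat_pow_consistent by metis
    ultimately show ?thesis by blast
  qed
qed

lemma F_self_eq:
  assumes "subgroup Q P"
  shows "F Q Q = (\<lambda>m. restrict (f m) Q) ` setwise_stab {Q}"
proof -
  have "f m ` Q \<subseteq> Q \<longleftrightarrow> f m ` Q = Q" if "m \<in> carrier G" for m
    using f_image_eq[OF that] subgroup.subset[OF assms] finite_subset_P by blast
  then show ?thesis
    unfolding F_eq[OF assms assms] setwise_stab_def by auto
qed

theorem p_stable: "p_stable p P F"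
proof (rule p_stable_if_Aut_image[where M = "\<lambda>Q. G\<lparr>carrier := setwise_stab {Q}\<rparr>"
      and \<theta> = "\<lambda>Q m. restrict (f m) Q" and K = "\<lambda>Q. S \<inter> setwise_stab {Q}" and n = n and j = j])
  show "Factorial_Ring.prime p" "finite_p_group p P" "coprime j p"
    using prime_p p_group coprime_j by auto
next
  fix Q assume Q: "subgroup Q P"
  then have sub: "Q \<subseteq> carrier P" using subgroup.subset by blast
  have M: "subgroup (setwise_stab {Q}) G" using subgroup_setwise_stab[of "{Q}"] sub by simp
  show "group_hom (G\<lparr>carrier := setwise_stab {Q}\<rparr>) (BijGroup Q) (\<lambda>m. restrict (f m) Q)"
  proof (rule G.action_hom_BijGroup[OF M])
    fix m x assume "m \<in> setwise_stab {Q}" "x \<in> Q"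
    then show "f m x \<in> Q" using setwise_stab_image by blast
  next
    fix x assume "x \<in> Q" then show "f \<one>\<^bsub>G\<^esub> x = x" using f_one sub by blast
  next
    fix m n x assume "m \<in> setwise_stab {Q}" "n \<in> setwise_stab {Q}" "x \<in> Q"
    then show "f (m \<otimes>\<^bsub>G\<^esub> n) x = f m (f n x)"
      using f_mult setwise_stab_carrier sub by blast
  qed
  show "F Q Q = (\<lambda>m. restrict (f m) Q) ` carrier (G\<lparr>carrier := setwise_stab {Q}\<rparr>)"
    using F_self_eq[OF Q] by simp
  show "\<chi> \<in> hom (P\<lparr>carrier := Q\<rparr>) (P\<lparr>carrier := Q\<rparr>)" if \<chi>: "\<chi> \<in> F Q Q" for \<chi>
  proof -
    obtain m where m: "m \<in> carrier G" "f m ` Q = Q" "\<chi> = restrict (f m) Q"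
      using \<chi> unfolding F_self_eq[OF Q] by (auto simp: setwise_stab_def)
    then have "f m x \<in> Q" if "x \<in> Q" for x using that by blast
    moreover have "f m (x \<otimes> y) = f m x \<otimes> f m y" if "x \<in> Q" "y \<in> Q" for x y
      using hom_mult[OF f_hom[OF m(1)]] that sub by blast
    ultimately show ?thesis
      using subgroup.m_closed[OF Q] by (simp add: hom_def m(3))
  qed
  show "S \<inter> setwise_stab {Q} \<lhd> G\<lparr>carrier := setwise_stab {Q}\<rparr>"
    by (rule S_Int(1)[OF M])
  show "finite (S \<inter> setwise_stab {Q})" by (rule S_Int(2)[OF M])
  show "card (S \<inter> setwise_stab {Q}) dvd p ^ n" by (rule S_Int(3)[OF M])
  show "m [^]\<^bsub>G\<lparr>carrier := setwise_stab {Q}\<rparr>\<^esub> j \<in> S \<inter> setwise_stab {Q}"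
    if "m \<in> carrier (G\<lparr>carrier := setwise_stab {Q}\<rparr>)" for m
    using S_Int(4)[OF M] that by simp
qed

text \<open>\<open>quotient_fusion\<close> quantifies existentially over the subgroups lying above
  two given sets of cosets. This recovers each of them as a union, so they are unique.\<close>

lemma carrier_Mod_Union:
  assumes T: "subgroup T P" and R: "subgroup R P" "R \<subseteq> T"
  shows "\<Union>(carrier (P\<lparr>carrier := T\<rparr> Mod R)) = T"
proof -
  have "R #> x \<subseteq> T" if "x \<in> T" for x
    using that R subgroup.m_closed[OF T] by (auto simp: r_coset_def)
  moreover have "x \<in> R #> x" if "x \<in> T" for x
    using that rcos_self[OF subgroup.mem_carrier[OF T] R(1)] by blast
  ultimately show ?thesis
    by (fastforce simp: carrier_FactGroup)
qed

text \<open>For R inside T the product TR is T, so the extension demanded by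
  \<open>normaliser_fusion\<close> is \<phi> itself, and its only content is that \<phi> maps R onto
  R.\<close>

lemma F_stab_eq:
  assumes T: "subgroup T P" and "\<phi> \<in> F T T" and \<psi>: "\<psi> \<in> F T T" "\<psi> ` R = R" "\<forall>x\<in>T. \<psi> x = \<phi> x"
    and R: "R \<subseteq> T"
  obtains m where "m \<in> setwise_stab {T, R}" "\<phi> = restrict (f m) T"
proof -
  obtain m where m: "m \<in> setwise_stab {T}" "\<phi> = restrict (f m) T"
    using assms(2) F_self_eq[OF T] by blast
  have "f m ` R = \<psi> ` R"
    using \<psi>(3) R by (intro image_cong) (auto simp: m(2) subset_iff)
  then show thesis
    using m \<psi>(2) that[of m] by (simp add: setwise_stab_def)
qed

text \<open>If m stabilises R, then f m sends the coset R x to the coset of f m x. The map induced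
  on T/R is thus the plain image map on sets, free of any choice of representatives, and the
  automorphism group of the section is again the image of a stabiliser in G.\<close>

lemma quotient_fusion_self_eq:
  assumes R: "subgroup R P"
    and T: "subgroup T P" "R \<subseteq> T" "T \<subseteq> normalizer P R"
    and A: "A = carrier (P\<lparr>carrier := T\<rparr> Mod R)"
  shows "quotient_fusion (P\<lparr>carrier := normalizer P R\<rparr>) (normaliser_fusion P F R) R A A =
    (\<lambda>m. restrict ((`) (f m)) A) ` setwise_stab {T, R}"
proof -
  let ?N = "P\<lparr>carrier := normalizer P R\<rparr>"
  have NR: "subgroup (normalizer P R) P"
    using normalizer_imp_subgroup[OF subgroup.subset[OF R]] .
  have A_eq: "A = (\<lambda>x. R #> x) ` T"
    by (simp add: A carrier_FactGroup)
  have TR: "T <#> R = T"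
    using set_mult_subgroup_idem[OF T(1) subgroup_incl[OF R T(1,2)]] .
  have coset: "f m ` (R #> x) = R #> f m x" if "m \<in> setwise_stab {T, R}" "x \<in> T" for m x
  proof -
    have m: "m \<in> carrier G" and fR: "f m ` R = R" using that by (auto simp: setwise_stab_def)
    have x: "x \<in> carrier P" using that T subgroup.mem_carrier by metis
    have "f m ` (R #> x) = (\<lambda>r. f m (r \<otimes> x)) ` R"
      by (auto simp: r_coset_def)
    also have "\<dots> = (\<lambda>r. f m r \<otimes> f m x) ` R"
      using hom_mult[OF f_hom[OF m]] x subgroup.mem_carrier[OF R] by (intro image_cong) auto
    also have "\<dots> = (\<lambda>r. r \<otimes> f m x) ` f m ` R" by (simp add: image_image)
    also have "\<dots> = R #> f m x" unfolding fR by (auto simp: r_coset_def)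
    finally show ?thesis .
  qed
  show ?thesis
  proof (intro equalityI subsetI)
    fix \<psi> assume "\<psi> \<in> quotient_fusion ?N (normaliser_fusion P F R) R A A"
    then obtain T' R' \<phi> where \<psi>: "\<psi> \<in> A \<rightarrow>\<^sub>E A"
      and T': "subgroup T' ?N" "R \<subseteq> T'" "A = carrier (P\<lparr>carrier := T'\<rparr> Mod R)"
      and R': "subgroup R' ?N" "R \<subseteq> R'" "A = carrier (P\<lparr>carrier := R'\<rparr> Mod R)"
      and \<phi>: "\<phi> \<in> normaliser_fusion P F R T' R'" "\<forall>x\<in>T'. \<psi> (R #> x) = R #> \<phi> x"
      unfolding quotient_fusion_def by (elim CollectE conjE exE) (rule that, simp_all)
    have TT: "\<Union>A = T" using carrier_Mod_Union[OF T(1) R T(2)] A by simp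
    have "T' = T"
      using carrier_Mod_Union[OF incl_subgroup[OF NR T'(1)] R T'(2)] T'(3) TT by simp
    moreover have "R' = T"
      using carrier_Mod_Union[OF incl_subgroup[OF NR R'(1)] R R'(2)] R'(3) TT by simp
    ultimately obtain m where m: "m \<in> setwise_stab {T, R}" "\<phi> = restrict (f m) T"
      using \<phi>(1) F_stab_eq[OF T(1) _ _ _ _ T(2)] TR by (auto simp: normaliser_fusion_def)
    have "\<psi> X = restrict ((`) (f m)) A X" for X
    proof (cases "X \<in> A")
      case True
      then obtain x where "x \<in> T" "X = R #> x" using A_eq by blast
      then show ?thesis
        using True \<phi>(2) coset[OF m(1)] by (simp add: \<open>T' = T\<close> m(2))
    next
      case False
      then show ?thesis using \<psi> by (simp add: PiE_arb[of \<psi> A "\<lambda>_. A"])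
    qed
    then have "\<psi> = restrict ((`) (f m)) A" by (rule ext)
    then show "\<psi> \<in> (\<lambda>m. restrict ((`) (f m)) A) ` setwise_stab {T, R}"
      using m(1) by blast
  next
    fix \<psi> assume "\<psi> \<in> (\<lambda>m. restrict ((`) (f m)) A) ` setwise_stab {T, R}"
    then obtain m where m: "m \<in> setwise_stab {T, R}" "\<psi> = restrict ((`) (f m)) A" by blast
    define \<phi> where "\<phi> = restrict (f m) T"
    have fT: "f m ` T = T" and fR: "f m ` R = R"
      using m(1) by (auto simp: setwise_stab_def)
    have "\<phi> \<in> F T T"
      using m(1) unfolding F_self_eq[OF T(1)] \<phi>_def by (auto simp: setwise_stab_def)
    moreover have "\<phi> ` R = R"
      using T(2) unfolding \<phi>_def by (subst (2) fR[symmetric]) (intro image_cong, auto)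
    ultimately have "\<phi> \<in> normaliser_fusion P F R T T"
      using TR by (auto simp: normaliser_fusion_def)
    moreover have "\<psi> (R #> x) = R #> \<phi> x" if "x \<in> T" for x
      using that coset[OF m(1)] A_eq by (simp add: m(2) \<phi>_def)
    moreover have "\<psi> \<in> A \<rightarrow>\<^sub>E A"
    proof -
      have "f m ` X \<in> A" if "X \<in> A" for X
      proof -
        obtain x where "x \<in> T" "X = R #> x" using \<open>X \<in> A\<close> A_eq by blast
        then show ?thesis using coset[OF m(1)] fT A_eq by auto
      qed
      then show ?thesis by (simp add: m(2))
    qed
    moreover have "subgroup T ?N" using subgroup_incl[OF T(1) NR T(3)] .
    ultimately show "\<psi> \<in> quotient_fusion ?N (normaliser_fusion P F R) R A A"
      unfolding quotient_fusion_def using T(2) A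
      by (intro CollectI conjI exI[of _ T] exI[of _ \<phi>]) auto
  qed
qed

text \<open>A subgroup A of the quotient of the normaliser by R is T/R for T the union of A. The
  criterion applies with the stabiliser of T and R as acting group and its intersection with S as
  normal p-subgroup.\<close>

theorem section_p_stable: "section_p_stable p P F"
  unfolding section_p_stable_def Let_def
proof (intro allI impI)
  fix R assume "fully_normalised P F R"
  then have R: "subgroup R P" by (simp add: fully_normalised_def)
  let ?N = "P\<lparr>carrier := normalizer P R\<rparr>"
  let ?F = "quotient_fusion ?N (normaliser_fusion P F R) R"
  have NR: "subgroup (normalizer P R) P"
    using normalizer_imp_subgroup[OF subgroup.subset[OF R]] .
  interpret N: group ?N by (rule subgroup_imp_group[OF NR])
  have RN: "R \<lhd> ?N" using normal_in_normalizer[OF R] .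
  interpret RN: normal R ?N by (rule RN)
  have T: "subgroup (\<Union>A) P \<and> R \<subseteq> \<Union>A \<and> \<Union>A \<subseteq> normalizer P R \<and>
      A = carrier (P\<lparr>carrier := \<Union>A\<rparr> Mod R)" if A: "subgroup A (?N Mod R)" for A
  proof -
    have "subgroup (\<Union>A) ?N" using RN.factgroup_subgroup_union_subgroup[OF A] .
    then have "subgroup (\<Union>A) P" "\<Union>A \<subseteq> normalizer P R"
      using incl_subgroup[OF NR] subgroup.subset by force+
    moreover have "R \<in> A" using subgroup.one_closed[OF A] by simp
    moreover have "A = carrier (P\<lparr>carrier := \<Union>A\<rparr> Mod R)"
      using RN.factgroup_subgroup_union_factor[OF A] by (simp add: FactGroup_def)
    ultimately show ?thesis by blast
  qed
  have F_A: "?F A A = (\<lambda>m. restrict ((`) (f m)) A) ` setwise_stab {\<Union>A, R}"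
    if A: "subgroup A (?N Mod R)" for A
    using quotient_fusion_self_eq[OF R, of "\<Union>A" A] T[OF A] by blast
  have A_sub: "X \<subseteq> carrier P" if "subgroup A (?N Mod R)" "X \<in> A" for A X
    using T[OF that(1)] subgroup.subset that(2) by blast
  have A_closed: "f m ` X \<in> A"
    if A: "subgroup A (?N Mod R)" and m: "m \<in> setwise_stab {\<Union>A, R}" and X: "X \<in> A" for A m X
  proof -
    have "restrict ((`) (f m)) A \<in> ?F A A" using F_A[OF A] m by blast
    then have "restrict ((`) (f m)) A \<in> A \<rightarrow>\<^sub>E A" by (simp add: quotient_fusion_def)
    then show ?thesis using X by auto
  qed
  have M: "subgroup (setwise_stab {\<Union>A, R}) G" if "subgroup A (?N Mod R)" for A
    using T[OF that] subgroup.subset[OF R] subgroup.subset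
    by (intro subgroup_setwise_stab) blast
  show "p_stable p (?N Mod R) ?F"
  proof (rule p_stable_if_Aut_image[where M = "\<lambda>A. G\<lparr>carrier := setwise_stab {\<Union>A, R}\<rparr>"
      and \<theta> = "\<lambda>A m. restrict ((`) (f m)) A" and K = "\<lambda>A. S \<inter> setwise_stab {\<Union>A, R}"
      and n = n and j = j])
    show "Factorial_Ring.prime p" "coprime j p" using prime_p coprime_j by auto
    show "finite_p_group p (?N Mod R)"
    proof -
      obtain e where e: "order P = p ^ e" using p_group by (auto simp: finite_p_group_def)
      have "order (?N Mod R) * card R = card (normalizer P R)"
        using N.lagrange[OF RN.is_subgroup] by (simp add: order_def FactGroup_def)
      moreover have "card (rcosets normalizer P R) * card (normalizer P R) = order P"
        using lagrange[OF NR] .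
      ultimately have "order (?N Mod R) dvd p ^ e"
        using e by (metis dvd_mult dvd_triv_left)
      then have "\<exists>i. order (?N Mod R) = p ^ i" using divides_primepow_nat[OF prime_p] by auto
      moreover have "finite (carrier (?N Mod R))"
        using finite_subset_P[OF subgroup.subset[OF NR]] by (simp add: carrier_FactGroup)
      ultimately show ?thesis
        using RN.factorgroup_is_group by (simp add: finite_p_group_def)
    qed
  next
    fix A assume A: "subgroup A (?N Mod R)"
    show "group_hom (G\<lparr>carrier := setwise_stab {\<Union>A, R}\<rparr>) (BijGroup A) (\<lambda>m. restrict ((`) (f m)) A)"
    proof (rule G.action_hom_BijGroup[OF M[OF A]])
      fix m X assume "m \<in> setwise_stab {\<Union>A, R}" "X \<in> A"
      then show "f m ` X \<in> A" by (rule A_closed[OF A])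
    next
      fix X assume "X \<in> A"
      then show "f \<one>\<^bsub>G\<^esub> ` X = X" using A_sub[OF A] f_one by (force simp: subset_iff)
    next
      fix m n X assume "m \<in> setwise_stab {\<Union>A, R}" "n \<in> setwise_stab {\<Union>A, R}" "X \<in> A"
      then show "f (m \<otimes>\<^bsub>G\<^esub> n) ` X = f m ` f n ` X"
        unfolding image_image using f_mult setwise_stab_carrier A_sub[OF A]
        by (intro image_cong refl) blast
    qed
    show "?F A A = (\<lambda>m. restrict ((`) (f m)) A) ` carrier (G\<lparr>carrier := setwise_stab {\<Union>A, R}\<rparr>)"
      using F_A[OF A] by simp
    show "\<chi> \<in> hom ((?N Mod R)\<lparr>carrier := A\<rparr>) ((?N Mod R)\<lparr>carrier := A\<rparr>)" if \<chi>: "\<chi> \<in> ?F A A" for \<chi>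
    proof -
      obtain m where m: "m \<in> setwise_stab {\<Union>A, R}" "\<chi> = restrict ((`) (f m)) A"
        using \<chi> F_A[OF A] by blast
      have "f m ` (X <#> Y) = f m ` X <#> f m ` Y" if "X \<in> A" "Y \<in> A" for X Y
        using set_mult_hom[OF f_hom[OF setwise_stab_carrier[OF m(1)]]] A_sub[OF A] that by blast
      moreover have "X <#> Y \<in> A" if "X \<in> A" "Y \<in> A" for X Y
        using subgroup.m_closed[OF A that] by simp
      ultimately show ?thesis
        using A_closed[OF A m(1)] by (simp add: hom_def m(2))
    qed
    show "S \<inter> setwise_stab {\<Union>A, R} \<lhd> G\<lparr>carrier := setwise_stab {\<Union>A, R}\<rparr>"
      by (rule S_Int(1)[OF M[OF A]])
    show "finite (S \<inter> setwise_stab {\<Union>A, R})" by (rule S_Int(2)[OF M[OF A]])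
    show "card (S \<inter> setwise_stab {\<Union>A, R}) dvd p ^ n" by (rule S_Int(3)[OF M[OF A]])
    show "m [^]\<^bsub>G\<lparr>carrier := setwise_stab {\<Union>A, R}\<rparr>\<^esub> j \<in> S \<inter> setwise_stab {\<Union>A, R}"
      if "m \<in> carrier (G\<lparr>carrier := setwise_stab {\<Union>A, R}\<rparr>)" for m
      using S_Int(4)[OF M[OF A]] that by simp
  qed
qed

end

section \<open>Fusion systems of semidirect products\<close>

lemma (in group) internal_semidirect_order_Mod:
  assumes semi: "internal_semidirect G S H"
  shows "order (G Mod S) = card H"
proof -
  have S: "S \<lhd> G" and H: "subgroup H G" and SH: "S \<inter> H = {\<one>}" "S <#> H = carrier G"
    using semi by (auto simp: internal_semidirect_def)
  interpret S: normal S G by (rule S)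
  have "bij_betw (\<lambda>h. S #> h) H (carrier (G Mod S))"
  proof (rule bij_betwI')
    fix h k assume h: "h \<in> H" and k: "k \<in> H"
    show "(S #> h = S #> k) = (h = k)"
    proof
      assume "S #> h = S #> k"
      then have "h \<in> S #> k" using rcos_self[OF _ S.is_subgroup] subgroup.mem_carrier[OF H h] by blast
      then have "h \<otimes> inv k \<in> S"
        using S.rcos_module_imp[OF is_group] subgroup.mem_carrier[OF H] h k by blast
      moreover have "h \<otimes> inv k \<in> H"
        using h k H by (simp add: subgroup.m_closed subgroup.m_inv_closed)
      ultimately have "h \<otimes> inv k = \<one>" using SH by blast
      then show "h = k"
        using subgroup.mem_carrier[OF H h] subgroup.mem_carrier[OF H k] by (metis inv_equality inv_closed inv_inv)
    qed simp
  next
    fix h assume "h \<in> H"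
    then show "S #> h \<in> carrier (G Mod S)"
      using subgroup.mem_carrier[OF H] by (auto simp: carrier_FactGroup)
  next
    fix X assume "X \<in> carrier (G Mod S)"
    then obtain g where g: "g \<in> carrier G" "X = S #> g" by (auto simp: carrier_FactGroup)
    then obtain s h where sh: "s \<in> S" "h \<in> H" "g = s \<otimes> h"
      using SH(2) by (force simp: set_mult_def)
    then have "X = S #> h"
      using g coset_mult_assoc[of S s h] S.rcos_const[OF is_group sh(1)] S.subset
        subgroup.mem_carrier[OF H sh(2)] by simp
    then show "\<exists>h\<in>H. X = S #> h" using sh by blast
  qed
  then show ?thesis
    by (simp add: order_def bij_betw_same_card)
qed

lemma (in group) internal_semidirect_pow_mem:
  assumes semi: "internal_semidirect G S H" and fin: "finite (carrier G)" and m: "m \<in> carrier G"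
  shows "m [^] card H \<in> S"
proof -
  interpret S: normal S G using semi by (simp add: internal_semidirect_def)
  show ?thesis
    using S.pow_order_Mod_mem[OF fin m] internal_semidirect_order_Mod[OF semi] by simp
qed

theorem p_stable_if_realised_by:
  assumes p: "Factorial_Ring.prime p" and P: "finite_p_group p P" and real: "realised_by p P F G S H \<iota>"
  shows "p_stable p P F \<and> section_p_stable p P F"
proof -
  interpret P: group P using P by (simp add: finite_p_group_def)
  have finG: "finite (carrier G)" and semi: "internal_semidirect G S H" and H: "\<not> p dvd card H"
    and \<iota>: "\<iota> \<in> iso P (G\<lparr>carrier := S\<rparr>)"
    and F: "\<And>Q R. subgroup Q P \<Longrightarrow> subgroup R P \<Longrightarrow>
        F Q R = {\<phi> \<in> Q \<rightarrow>\<^sub>E R. \<exists>\<psi>\<in>conj_fusion G (\<iota> ` Q) (\<iota> ` R). \<forall>x\<in>Q. \<iota> (\<phi> x) = \<psi> (\<iota> x)}"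
    and G: "group G"
    using real by (auto simp: realised_by_def)
  interpret G: group G by (rule G)
  have S: "S \<lhd> G" using semi by (simp add: internal_semidirect_def)
  interpret S: normal S G by (rule S)
  have \<iota>_hom: "\<iota> (x \<otimes>\<^bsub>P\<^esub> y) = \<iota> x \<otimes>\<^bsub>G\<^esub> \<iota> y" if "x \<in> carrier P" "y \<in> carrier P" for x y
    using \<iota> that by (simp add: iso_def hom_def)
  have \<iota>_bij: "bij_betw \<iota> (carrier P) S" using \<iota> by (simp add: iso_def)
  have \<iota>S: "\<iota> x \<in> S" if "x \<in> carrier P" for x using \<iota>_bij that by (auto simp: bij_betw_def)
  have \<iota>_eqD: "x = y" if "\<iota> x = \<iota> y" "x \<in> carrier P" "y \<in> carrier P" for x y
    using \<iota>_bij that by (auto simp: bij_betw_def inj_on_def)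
  \<comment> \<open>Conjugation by \<open>inv m\<close> turns the right action into a left one.
    Since inversion permutes G, the set of induced morphisms is unchanged.\<close>
  define f where "f m x = inv_into (carrier P) \<iota> (conj_by G (inv\<^bsub>G\<^esub> m) (\<iota> x))" for m x
  have conjS: "conj_by G m s \<in> S" if "m \<in> carrier G" "s \<in> S" for m s
    using S.inv_op_closed1[OF that] by (simp add: conj_by_def)
  have \<iota>_f: "\<iota> (f m x) = conj_by G (inv\<^bsub>G\<^esub> m) (\<iota> x)" if "m \<in> carrier G" "x \<in> carrier P" for m x
    unfolding f_def using \<iota>_bij conjS \<iota>S that by (simp add: bij_betw_inv_into_right)
  have f_closed: "f m x \<in> carrier P" if "m \<in> carrier G" "x \<in> carrier P" for m x
    unfolding f_def using \<iota>_bij conjS \<iota>S that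
    by (metis G.inv_closed bij_betw_def inv_into_into)
  obtain n where n: "order P = p ^ n" using P by (auto simp: finite_p_group_def)
  interpret fusion_of_p_closed_action P G F f p n "card H" S
  proof (intro fusion_of_p_closed_action.intro fusion_of_p_closed_action_axioms.intro
      fusion_of_action.intro fusion_of_action_axioms.intro P.is_group G)
    fix m assume m: "m \<in> carrier G"
    show "f m \<in> hom P P"
    proof (rule homI)
      fix x y assume xy: "x \<in> carrier P" "y \<in> carrier P"
      have "\<iota> (f m (x \<otimes>\<^bsub>P\<^esub> y)) = \<iota> (f m x \<otimes>\<^bsub>P\<^esub> f m y)"
        using m xy by (simp add: \<iota>_f \<iota>_hom f_closed G.conj_by_mult \<iota>S)
      then show "f m (x \<otimes>\<^bsub>P\<^esub> y) = f m x \<otimes>\<^bsub>P\<^esub> f m y"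
        using \<iota>_eqD f_closed m xy by simp
    qed (use f_closed m in auto)
  next
    fix x assume x: "x \<in> carrier P"
    have "\<iota> (f \<one>\<^bsub>G\<^esub> x) = \<iota> x" using x by (simp add: \<iota>_f \<iota>S)
    then show "f \<one>\<^bsub>G\<^esub> x = x" using \<iota>_eqD f_closed x by simp
  next
    fix m k x assume mk: "m \<in> carrier G" "k \<in> carrier G" and x: "x \<in> carrier P"
    have "\<iota> (f (m \<otimes>\<^bsub>G\<^esub> k) x) = \<iota> (f m (f k x))"
      using mk x by (simp add: \<iota>_f f_closed G.conj_by_conj_by G.inv_mult_group \<iota>S)
    then show "f (m \<otimes>\<^bsub>G\<^esub> k) x = f m (f k x)"
      using \<iota>_eqD f_closed mk x by simp
  next
    fix Q R assume Q: "subgroup Q P" and R: "subgroup R P"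
    have QP: "Q \<subseteq> carrier P" and RP: "R \<subseteq> carrier P" using Q R subgroup.subset by auto
    have image: "conj_by G (inv\<^bsub>G\<^esub> m) ` \<iota> ` Q \<subseteq> \<iota> ` R \<longleftrightarrow> f m ` Q \<subseteq> R" if m: "m \<in> carrier G" for m
    proof -
      have "conj_by G (inv\<^bsub>G\<^esub> m) ` \<iota> ` Q = \<iota> ` f m ` Q"
        using QP m \<iota>_f by (auto simp: image_image subset_iff intro!: image_cong)
      moreover have "f m ` Q \<subseteq> R" if sub: "\<iota> ` f m ` Q \<subseteq> \<iota> ` R"
      proof
        fix y assume y: "y \<in> f m ` Q"
        then obtain r where "r \<in> R" "\<iota> y = \<iota> r" using sub by blast
        moreover have "y \<in> carrier P" using y QP f_closed m by blast
        ultimately show "y \<in> R" using \<iota>_eqD RP by blast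
      qed
      ultimately show ?thesis by auto
    qed
    show "F Q R = {restrict (f m) Q |m. m \<in> carrier G \<and> f m ` Q \<subseteq> R}"
    proof (intro equalityI subsetI)
      fix \<phi> assume "\<phi> \<in> F Q R"
      then obtain \<psi> where \<phi>: "\<phi> \<in> Q \<rightarrow>\<^sub>E R" "\<psi> \<in> conj_fusion G (\<iota> ` Q) (\<iota> ` R)"
          "\<forall>x\<in>Q. \<iota> (\<phi> x) = \<psi> (\<iota> x)"
        using F[OF Q R] by blast
      then obtain g where g: "g \<in> carrier G" "conj_by G g ` \<iota> ` Q \<subseteq> \<iota> ` R"
        "\<psi> = restrict (conj_by G g) (\<iota> ` Q)" by (auto simp: conj_fusion_def)
      have "\<phi> x = f (inv\<^bsub>G\<^esub> g) x" if "x \<in> Q" for x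
      proof -
        have "\<phi> x \<in> carrier P" using \<phi>(1) that RP by auto
        moreover have "\<iota> (\<phi> x) = \<iota> (f (inv\<^bsub>G\<^esub> g) x)"
          using \<phi>(3) g that QP \<iota>_f[of "inv\<^bsub>G\<^esub> g" x] by auto
        ultimately show ?thesis
          using \<iota>_eqD f_closed[of "inv\<^bsub>G\<^esub> g" x] g that QP by auto
      qed
      then have "\<phi> = restrict (f (inv\<^bsub>G\<^esub> g)) Q"
        using \<phi>(1) by (auto simp: PiE_def extensional_def)
      moreover have "f (inv\<^bsub>G\<^esub> g) ` Q \<subseteq> R"
        using image[of "inv\<^bsub>G\<^esub> g"] g by simp
      ultimately show "\<phi> \<in> {restrict (f m) Q |m. m \<in> carrier G \<and> f m ` Q \<subseteq> R}"
        using g by (intro CollectI exI[of _ "inv\<^bsub>G\<^esub> g"]) simp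
    next
      fix \<phi> assume "\<phi> \<in> {restrict (f m) Q |m. m \<in> carrier G \<and> f m ` Q \<subseteq> R}"
      then obtain m where m: "m \<in> carrier G" "f m ` Q \<subseteq> R" "\<phi> = restrict (f m) Q" by blast
      define \<psi> where "\<psi> = restrict (conj_by G (inv\<^bsub>G\<^esub> m)) (\<iota> ` Q)"
      have "\<psi> \<in> conj_fusion G (\<iota> ` Q) (\<iota> ` R)"
        unfolding conj_fusion_def \<psi>_def using m image[OF m(1)]
        by (intro CollectI exI[of _ "inv\<^bsub>G\<^esub> m"]) simp
      moreover have "\<forall>x\<in>Q. \<iota> (\<phi> x) = \<psi> (\<iota> x)"
        using \<iota>_f[OF m(1)] QP by (auto simp: \<psi>_def m(3))
      moreover have "\<phi> \<in> Q \<rightarrow>\<^sub>E R" using m by auto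
      ultimately show "\<phi> \<in> F Q R" using F[OF Q R] by blast
    qed
  next
    show "S \<lhd> G" by (rule S)
    show "finite S" using finite_subset[OF S.subset finG] .
    show "card S dvd p ^ n" using n bij_betw_same_card[OF \<iota>_bij] by (simp add: order_def)
    show "coprime (card H) p" using prime_imp_coprime[OF p H] coprime_commute by blast
    show "m [^]\<^bsub>G\<^esub> card H \<in> S" if "m \<in> carrier G" for m
      using G.internal_semidirect_pow_mem[OF semi finG that] .
  qed (use p P in auto)
  show ?thesis using p_stable section_p_stable by blast
qed

section \<open>Complements of abelian normal subgroups\<close>

text \<open>With a transversal \<open>t\<close> of \<open>N\<close>, the map
  \<open>e a = \<Prod>c. a t(c) t(ac)\<inverse>\<close> is a crossed homomorphism into \<open>N\<close> whose restriction to \<open>N\<close> is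
  the power map \<open>n \<mapsto> n\<^bsup>|G:N|\<^esup>\<close>, which is bijective. Hence the kernel of \<open>e\<close> is a complement.\<close>

lemma (in group) abelian_normal_complement:
  assumes N: "N \<lhd> G" and fin: "finite (carrier G)"
    and comm: "\<And>x y. x \<in> N \<Longrightarrow> y \<in> N \<Longrightarrow> x \<otimes> y = y \<otimes> x"
    and coprime: "coprime (card N) (order (G Mod N))"
  obtains H where "internal_semidirect G N H"
proof -
  interpret N: normal N G by (rule N)
  interpret Mod: group "G Mod N" by (rule N.factorgroup_is_group)
  interpret A: comm_group "G\<lparr>carrier := N\<rparr>"
    using subgroup_imp_group[OF N.is_subgroup] comm
    by (intro group.group_comm_groupI) auto
  define C where "C = carrier (G Mod N)"
  define m where "m = card C"
  have m: "m = order (G Mod N)" by (simp add: m_def C_def order_def)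
  define t where "t c = (SOME x. x \<in> carrier G \<and> N #> x = c)" for c
  have t: "t c \<in> carrier G" "N #> t c = c" if "c \<in> C" for c
  proof -
    have "\<exists>x. x \<in> carrier G \<and> N #> x = c" using that by (auto simp: C_def carrier_FactGroup)
    then show "t c \<in> carrier G" "N #> t c = c" unfolding t_def by (metis (mono_tags, lifting) someI_ex)+
  qed
  \<comment> \<open>This is the permutation of the cosets by left multiplication with a. Both a t(c)
    and t(s a c) represent the coset s a c, so their quotient \<open>E a c\<close> falls into
    N.\<close>
  define s where "s a c = (N #> a) <#> c" for a c
  have s_Mod: "s a c = (N #> a) \<otimes>\<^bsub>G Mod N\<^esub> c" for a c by (simp add: s_def)
  have coset_C: "N #> a \<in> carrier (G Mod N)" if "a \<in> carrier G" for a
    using that by (auto simp: carrier_FactGroup)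
  have s_C: "s a c \<in> C" if "a \<in> carrier G" "c \<in> C" for a c
    using Mod.m_closed[OF coset_C[OF that(1)]] that by (simp add: C_def s_def)
  have s_mult: "s (a \<otimes> b) c = s a (s b c)" if "a \<in> carrier G" "b \<in> carrier G" "c \<in> C" for a b c
    using that N.rcos_sum[of a b] Mod.m_assoc[OF coset_C[OF that(1)] coset_C[OF that(2)], of c]
    by (simp add: s_def C_def)
  have s_bij: "inj_on (s a) C" "s a ` C = C" if a: "a \<in> carrier G" for a
  proof -
    show inj: "inj_on (s a) C"
      using Mod.inj_on_cmult[OF coset_C[OF a]] by (simp add: inj_on_def C_def s_Mod)
    have "finite C" using fin by (simp add: C_def carrier_FactGroup)
    then show "s a ` C = C"
      using inj s_C[OF a] by (intro endo_inj_surj) auto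
  qed
  define E where "E a c = a \<otimes> t c \<otimes> inv (t (s a c))" for a c
  have E_N: "E a c \<in> N" if "a \<in> carrier G" "c \<in> C" for a c
  proof -
    have "N #> (a \<otimes> t c) = (N #> a) <#> (N #> t c)"
      using N.rcos_sum[OF that(1) t(1)[OF that(2)]] by simp
    then have "N #> (a \<otimes> t c) = N #> t (s a c)"
      using t(2)[OF that(2)] t(2)[OF s_C[OF that]] by (simp add: s_def)
    then have "a \<otimes> t c \<in> N #> t (s a c)"
      using rcos_self[OF _ N.is_subgroup, of "a \<otimes> t c"] that t by simp
    then show ?thesis
      unfolding E_def using that t s_C by (intro N.rcos_module_imp[OF is_group]) auto
  qed
  have conj_N: "a \<otimes> x \<otimes> inv a \<in> N" if "a \<in> carrier G" "x \<in> N" for a x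
    using N.inv_op_closed2 that by blast
  \<comment> \<open>The inserted representative \<open>t (s b c)\<close> cancels. In the product
    over all c the last factor is merely reindexed by the permutation \<open>s b\<close>, which
    yields the crossed homomorphism law for e.\<close>
  have E_mult: "E (a \<otimes> b) c = (a \<otimes> E b c \<otimes> inv a) \<otimes> E a (s b c)"
    if a: "a \<in> carrier G" and b: "b \<in> carrier G" and c: "c \<in> C" for a b c
  proof -
    show ?thesis
      unfolding E_def using a b c t s_C s_mult by (simp add: m_assoc mult_inv_cancel_left)
  qed
  define e where "e a = finprod (G\<lparr>carrier := N\<rparr>) (E a) C" for a
  have E_Pi: "E a \<in> C \<rightarrow> carrier (G\<lparr>carrier := N\<rparr>)" if "a \<in> carrier G" for a
    using E_N[OF that] by simp
  have e_N: "e a \<in> N" if "a \<in> carrier G" for a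
    using A.finprod_closed[OF E_Pi[OF that]] by (simp add: e_def)
  \<comment> \<open>Conjugation by a is an endomorphism of the abelian group N, so it passes through
    the product. Over an infinite index set \<open>finprod\<close> is one and both sides are
    trivial.\<close>
  have finprod_conj: "finprod (G\<lparr>carrier := N\<rparr>) (\<lambda>c. a \<otimes> h c \<otimes> inv a) B
      = a \<otimes> finprod (G\<lparr>carrier := N\<rparr>) h B \<otimes> inv a"
    if a: "a \<in> carrier G" and "h \<in> B \<rightarrow> N" for a h and B :: "'a set set"
    using that(2)
  proof (induction B rule: infinite_finite_induct)
    case (insert b B)
    have h: "h \<in> B \<rightarrow> carrier (G\<lparr>carrier := N\<rparr>)" "h b \<in> N" using insert.prems by auto
    have P: "finprod (G\<lparr>carrier := N\<rparr>) h B \<in> N" using A.finprod_closed[OF h(1)] by simp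
    have "finprod (G\<lparr>carrier := N\<rparr>) (\<lambda>c. a \<otimes> h c \<otimes> inv a) (insert b B)
        = (a \<otimes> h b \<otimes> inv a) \<otimes> (a \<otimes> finprod (G\<lparr>carrier := N\<rparr>) h B \<otimes> inv a)"
      using insert conj_N[OF a] h by (subst A.finprod_insert) (auto simp: Pi_iff)
    also have "\<dots> = a \<otimes> (h b \<otimes> finprod (G\<lparr>carrier := N\<rparr>) h B) \<otimes> inv a"
      using a h(2) P by (simp add: m_assoc mult_inv_cancel_left)
    also have "h b \<otimes> finprod (G\<lparr>carrier := N\<rparr>) h B = finprod (G\<lparr>carrier := N\<rparr>) h (insert b B)"
      using insert h by (subst A.finprod_insert) auto
    finally show ?case .
  qed (use a in auto)
  have e_mult: "e (a \<otimes> b) = (a \<otimes> e b \<otimes> inv a) \<otimes> e a"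
    if a: "a \<in> carrier G" and b: "b \<in> carrier G" for a b
  proof -
    have conj_Pi: "(\<lambda>c. a \<otimes> E b c \<otimes> inv a) \<in> C \<rightarrow> carrier (G\<lparr>carrier := N\<rparr>)"
      using conj_N[OF a] E_N[OF b] by simp
    have Es_Pi: "(\<lambda>c. E a (s b c)) \<in> C \<rightarrow> carrier (G\<lparr>carrier := N\<rparr>)"
      using E_N[OF a] s_C[OF b] by simp
    have "e (a \<otimes> b) = finprod (G\<lparr>carrier := N\<rparr>)
        (\<lambda>c. (a \<otimes> E b c \<otimes> inv a) \<otimes>\<^bsub>G\<lparr>carrier := N\<rparr>\<^esub> E a (s b c)) C"
      unfolding e_def using E_mult[OF a b] conj_N[OF a] E_N a b s_C[OF b]
      by (intro A.finprod_cong') auto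
    also have "\<dots> = finprod (G\<lparr>carrier := N\<rparr>) (\<lambda>c. a \<otimes> E b c \<otimes> inv a) C
        \<otimes> finprod (G\<lparr>carrier := N\<rparr>) (\<lambda>c. E a (s b c)) C"
      using A.finprod_multf[OF conj_Pi Es_Pi] by simp
    also have "finprod (G\<lparr>carrier := N\<rparr>) (\<lambda>c. E a (s b c)) C = e a"
      using A.finprod_reindex[of "E a" "s b" C] s_bij[OF b] E_Pi[OF a] by (simp add: e_def)
    also have "finprod (G\<lparr>carrier := N\<rparr>) (\<lambda>c. a \<otimes> E b c \<otimes> inv a) C = a \<otimes> e b \<otimes> inv a"
      using finprod_conj[OF a, of "E b" C] E_N[OF b] by (simp add: e_def)
    finally show ?thesis .
  qed
  have e_pow: "e x = x [^] m" if x: "x \<in> N" for x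
  proof -
    have xG: "x \<in> carrier G" using x by simp
    have "E x c = x" if c: "c \<in> C" for c
    proof -
      have "s x c = c"
        using N.rcos_const[OF is_group x] Mod.l_one[of c] c by (simp add: s_def C_def)
      then show ?thesis
        unfolding E_def using xG t(1)[OF c] by (simp add: m_assoc)
    qed
    then have "e x = finprod (G\<lparr>carrier := N\<rparr>) (\<lambda>_. x) C"
      unfolding e_def using x by (intro A.finprod_cong') auto
    then show ?thesis
      using A.finprod_const[of x C] x nat_pow_consistent[of x m N] by (simp add: m_def)
  qed
  define H where "H = {a \<in> carrier G. e a = \<one>}"
  have H: "subgroup H G"
  proof (rule subgroupI)
    show "H \<subseteq> carrier G" by (auto simp: H_def)
    show "H \<noteq> {}" using e_pow[OF N.one_closed] by (auto simp: H_def)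
    show "a \<otimes> b \<in> H" if "a \<in> H" "b \<in> H" for a b
      using that e_mult[of a b] by (simp add: H_def)
    show "inv a \<in> H" if "a \<in> H" for a
    proof -
      have a: "a \<in> carrier G" "e a = \<one>" using that by (auto simp: H_def)
      have "\<one> = e (inv a \<otimes> a)" using e_pow[OF N.one_closed] a by simp
      also have "\<dots> = e (inv a)" using e_mult[of "inv a" a] a e_N[of "inv a"] by simp
      finally show ?thesis using a by (simp add: H_def)
    qed
  qed
  have "N \<inter> H = {\<one>}"
  proof (intro equalityI subsetI)
    fix x assume x: "x \<in> N \<inter> H"
    then have "x [^] m = \<one>" using e_pow by (auto simp: H_def)
    moreover have "x [^] card N = \<one>"
      using A.pow_order_eq_1[of x] x finite_subset[OF N.subset fin] nat_pow_consistent[of x "card N" N]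
      by (simp add: order_def)
    ultimately show "x \<in> {\<one>}"
      using mem_subgroup_if_coprime_powers[OF triv_subgroup, of x "card N" m] x coprime m by simp
  qed (use N.one_closed subgroup.one_closed[OF H] in simp)
  moreover have "N <#> H = carrier G"
  proof (intro equalityI subsetI)
    fix a assume a: "a \<in> carrier G"
    \<comment> \<open>Here u inverts m modulo |N|, so raising to the power u extracts m-th roots in
      N. \<open>bezout_nat\<close> requires a nonzero m, which holds because m counts a nonempty
      finite set of cosets.\<close>
    obtain u v where uv: "m * u = card N * v + 1"
    proof (cases "m = 0")
      case False
      then show thesis using bezout_nat[of m "card N"] that coprime m
        by (auto simp: coprime_iff_gcd_eq_1 gcd.commute)
    next
      case True
      have "C \<noteq> {}" using Mod.one_closed unfolding C_def by blast
      then show thesis using True fin by (simp add: m_def C_def carrier_FactGroup)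
    qed
    \<comment> \<open>With n an m-th root of \<open>inv (e a)\<close> in N, the crossed law gives e
      (n a) = e a x = 1, because conjugation by n is trivial on N. Hence n a lies in the kernel
      H.\<close>
    define x where "x = inv (e a)"
    have x: "x \<in> N" using e_N[OF a] by (simp add: x_def)
    have x1: "x [^] card N = \<one>"
      using A.pow_order_eq_1[of x] x finite_subset[OF N.subset fin] nat_pow_consistent[of x "card N" N]
      by (simp add: order_def)
    define n where "n = x [^] u"
    have n: "n \<in> N" using A.nat_pow_closed[of x u] x nat_pow_consistent[of x u N] by (simp add: n_def)
    have "n [^] m = x [^] (card N * v + 1)"
      using x uv by (simp add: n_def nat_pow_pow mult.commute)
    also have "\<dots> = x"
      using x x1 by (simp add: nat_pow_mult[symmetric] nat_pow_pow[symmetric])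
    finally have nm: "n [^] m = x" .
    have "e (n \<otimes> a) = (n \<otimes> e a \<otimes> inv n) \<otimes> x"
      using e_mult[of n a] e_pow[OF n] nm n a by simp
    also have "n \<otimes> e a = e a \<otimes> n" using comm n e_N[OF a] by blast
    also have "e a \<otimes> n \<otimes> inv n \<otimes> x = \<one>"
      using n e_N[OF a] by (simp add: x_def m_assoc)
    finally have "n \<otimes> a \<in> H" using n a by (simp add: H_def)
    moreover have "a = inv n \<otimes> (n \<otimes> a)" using n a by (simp add: m_assoc[symmetric])
    moreover have "inv n \<in> N" using n by simp
    ultimately show "a \<in> N <#> H" unfolding set_mult_def by blast
  next
    fix a assume "a \<in> N <#> H"
    then show "a \<in> carrier G" using subgroup.mem_carrier[OF H] by (auto simp: set_mult_def)
  qed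
  ultimately have "internal_semidirect G N H"
    using N H by (simp add: internal_semidirect_def)
  then show thesis by (rule that)
qed

section \<open>Realisation by a semidirect product\<close>

text \<open>The containment required by \<open>conj_fusion\<close> is automatic, because the
  conjugates are the values \<iota> (\<phi> x), which lie in the image of R. Only the pointwise
  equation has to be handled later.\<close>

lemma ex_conj_fusion_iff:
  assumes "\<phi> \<in> Q \<rightarrow> R"
  shows "(\<exists>\<psi>\<in>conj_fusion G (\<iota> ` Q) (\<iota> ` R). \<forall>x\<in>Q. \<iota> (\<phi> x) = \<psi> (\<iota> x)) \<longleftrightarrow>
    (\<exists>m\<in>carrier G. \<forall>x\<in>Q. \<iota> (\<phi> x) = conj_by G m (\<iota> x))"
proof
  assume "\<exists>\<psi>\<in>conj_fusion G (\<iota> ` Q) (\<iota> ` R). \<forall>x\<in>Q. \<iota> (\<phi> x) = \<psi> (\<iota> x)"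
  then show "\<exists>m\<in>carrier G. \<forall>x\<in>Q. \<iota> (\<phi> x) = conj_by G m (\<iota> x)"
    by (auto simp: conj_fusion_def)
next
  assume "\<exists>m\<in>carrier G. \<forall>x\<in>Q. \<iota> (\<phi> x) = conj_by G m (\<iota> x)"
  then obtain m where m: "m \<in> carrier G" "\<forall>x\<in>Q. \<iota> (\<phi> x) = conj_by G m (\<iota> x)" by blast
  then have "conj_by G m ` \<iota> ` Q \<subseteq> \<iota> ` R"
    using assms by (force simp: Pi_iff)
  then have "restrict (conj_by G m) (\<iota> ` Q) \<in> conj_fusion G (\<iota> ` Q) (\<iota> ` R)"
    using m(1) by (auto simp: conj_fusion_def)
  then show "\<exists>\<psi>\<in>conj_fusion G (\<iota> ` Q) (\<iota> ` R). \<forall>x\<in>Q. \<iota> (\<phi> x) = \<psi> (\<iota> x)"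
    using m(2) by (intro bexI[of _ "restrict (conj_by G m) (\<iota> ` Q)"]) auto
qed

lemma realised_by_iff:
  "realised_by p P F G S H \<iota> \<longleftrightarrow>
    group G \<and> finite (carrier G) \<and> internal_semidirect G S H \<and> \<not> p dvd card H \<and>
    \<iota> \<in> iso P (G\<lparr>carrier := S\<rparr>) \<and>
    (\<forall>Q R. subgroup Q P \<longrightarrow> subgroup R P \<longrightarrow>
      F Q R = {\<phi> \<in> Q \<rightarrow>\<^sub>E R. \<exists>m\<in>carrier G. \<forall>x\<in>Q. \<iota> (\<phi> x) = conj_by G m (\<iota> x)})"
proof -
  have "{\<phi> \<in> Q \<rightarrow>\<^sub>E R. \<exists>\<psi>\<in>conj_fusion G (\<iota> ` Q) (\<iota> ` R). \<forall>x\<in>Q. \<iota> (\<phi> x) = \<psi> (\<iota> x)} =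
    {\<phi> \<in> Q \<rightarrow>\<^sub>E R. \<exists>m\<in>carrier G. \<forall>x\<in>Q. \<iota> (\<phi> x) = conj_by G m (\<iota> x)}" for Q R
    using ex_conj_fusion_iff[of _ Q R G \<iota>] by (intro Collect_cong) (auto simp: PiE_def)
  then show ?thesis by (simp add: realised_by_def)
qed

text \<open>The group built below consists of permutations of P, while
  \<open>semidirect_fusion\<close> asks for natural numbers as elements. The whole configuration is
  moved along an injection of the finite carrier into the naturals.\<close>

lemma semidirect_fusion_if_realised_by:
  assumes P: "group P" and real: "realised_by p P F G S H \<iota>"
  shows "semidirect_fusion p P F"
proof -
  interpret P: group P by (rule P)
  have G: "group G" and fin: "finite (carrier G)" and semi: "internal_semidirect G S H"
    and H: "\<not> p dvd card H" and \<iota>: "\<iota> \<in> iso P (G\<lparr>carrier := S\<rparr>)"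
    and F: "\<And>Q R. subgroup Q P \<Longrightarrow> subgroup R P \<Longrightarrow>
      F Q R = {\<phi> \<in> Q \<rightarrow>\<^sub>E R. \<exists>m\<in>carrier G. \<forall>x\<in>Q. \<iota> (\<phi> x) = conj_by G m (\<iota> x)}"
    using real by (auto simp: realised_by_iff)
  interpret G: group G by (rule G)
  have S_normal: "S \<lhd> G" and sH: "subgroup H G" and SH: "S \<inter> H = {\<one>\<^bsub>G\<^esub>}" "S <#>\<^bsub>G\<^esub> H = carrier G"
    using semi by (auto simp: internal_semidirect_def)
  have sS: "subgroup S G" using S_normal normal_imp_subgroup by blast
  obtain g :: "_ \<Rightarrow> nat" where g: "inj_on g (carrier G)"
    using finite_imp_inj_to_nat_seg[OF fin] by blast
  define G' where "G' = image_group g G"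
  \<comment> \<open>An injection is a weak morphism with trivial kernel, and
    \<open>image_group\<close> then puts on its image the group structure that makes it a
    homomorphism.\<close>
  have "weak_group_morphism g {\<one>\<^bsub>G\<^esub>} G"
  proof (rule weak_group_morphismsI[OF G.one_is_normal])
    fix a b assume "a \<in> carrier G" "b \<in> carrier G"
    then show "g a = g b \<longleftrightarrow> a \<otimes>\<^bsub>G\<^esub> inv\<^bsub>G\<^esub> b \<in> {\<one>\<^bsub>G\<^esub>}"
      using g by (auto simp: inj_on_def) (metis G.inv_equality G.inv_closed G.inv_inv)
  qed
  then interpret g: group_hom G G' g
    unfolding G'_def by (rule G.weak_group_morphism_group_hom)
  have car: "carrier G' = g ` carrier G" by (simp add: G'_def image_group_carrier)
  have g_iso: "g \<in> iso G G'"
    using g g.homh car by (simp add: iso_def bij_betw_def)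
  have "internal_semidirect G' (g ` S) (g ` H)"
    unfolding internal_semidirect_def
  proof (intro conjI)
    show "g ` S \<lhd> G'" using iso_normal_subgroup[OF g_iso G g.H.is_group S_normal] .
    show "subgroup (g ` H) G'" using g.subgroup_img_is_subgroup[OF sH] .
    have "g ` S \<inter> g ` H = g ` (S \<inter> H)"
      using inj_on_image_Int[OF g, of S H] subgroup.subset[OF sS] subgroup.subset[OF sH] by blast
    then show "g ` S \<inter> g ` H = {\<one>\<^bsub>G'\<^esub>}" using SH(1) by simp
    show "g ` S <#>\<^bsub>G'\<^esub> g ` H = carrier G'"
      using set_mult_hom[OF g.homh subgroup.subset[OF sS] subgroup.subset[OF sH]] SH(2) car by simp
  qed
  moreover have "card (g ` H) = card H"
    using card_image inj_on_subset[OF g subgroup.subset[OF sH]] by blast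
  moreover have \<iota>_carrier: "\<iota> x \<in> carrier G" if "x \<in> carrier P" for x
    using \<iota> that subgroup.subset[OF sS] by (auto simp: iso_def bij_betw_def)
  have "g \<circ> \<iota> \<in> iso P (G'\<lparr>carrier := g ` S\<rparr>)"
  proof -
    have "bij_betw g S (g ` S)"
      using inj_on_subset[OF g subgroup.subset[OF sS]] by (simp add: bij_betw_def)
    then have "bij_betw (g \<circ> \<iota>) (carrier P) (g ` S)"
      using \<iota> bij_betw_trans by (auto simp: iso_def)
    moreover have "g (\<iota> (x \<otimes>\<^bsub>P\<^esub> y)) = g (\<iota> x) \<otimes>\<^bsub>G'\<^esub> g (\<iota> y)" if "x \<in> carrier P" "y \<in> carrier P" for x y
      using \<iota> that \<iota>_carrier by (simp add: iso_def hom_def)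
    ultimately show ?thesis
      by (auto simp: iso_def hom_def bij_betw_def)
  qed
  moreover have "F Q R = {\<phi> \<in> Q \<rightarrow>\<^sub>E R. \<exists>m\<in>carrier G'. \<forall>x\<in>Q. (g \<circ> \<iota>) (\<phi> x) = conj_by G' m ((g \<circ> \<iota>) x)}"
    if Q: "subgroup Q P" and R: "subgroup R P" for Q R
  proof -
    have QP: "\<And>x. x \<in> Q \<Longrightarrow> x \<in> carrier P" and RP: "\<And>x. x \<in> R \<Longrightarrow> x \<in> carrier P"
      using subgroup.mem_carrier Q R by metis+
    have "\<iota> (\<phi> x) = conj_by G m (\<iota> x) \<longleftrightarrow> (g \<circ> \<iota>) (\<phi> x) = conj_by G' (g m) ((g \<circ> \<iota>) x)"
      if "x \<in> Q" "\<phi> x \<in> R" "m \<in> carrier G" for x m \<phi>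
    proof -
      have "conj_by G' (g m) (g (\<iota> x)) = g (conj_by G m (\<iota> x))"
        using that \<iota>_carrier QP by (simp add: conj_by_def)
      then show ?thesis
        using inj_on_eq_iff[OF g] that \<iota>_carrier QP RP by simp
    qed
    then show ?thesis
      unfolding F[OF Q R] car by (intro Collect_cong) (auto simp: PiE_iff)
  qed
  ultimately have "realised_by p P F G' (g ` S) (g ` H) (g \<circ> \<iota>)"
    unfolding realised_by_iff using g.H.is_group fin H car by simp
  then show ?thesis unfolding semidirect_fusion_def by blast
qed

lemma (in group) conj_fusion_self_eq:
  "conj_fusion G (carrier G) (carrier G) = (\<lambda>g. restrict (conj_by G g) (carrier G)) ` carrier G"
  by (auto simp: conj_fusion_def)

section \<open>Restriction, change of codomain and automorphisms in a fusion system\<close>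

context fusion_system
begin

lemma F_hom:
  assumes "subgroup Q P" "subgroup R P" "\<phi> \<in> F Q R"
  shows "\<phi> \<in> hom (P\<lparr>carrier := Q\<rparr>) (P\<lparr>carrier := R\<rparr>)" "inj_on \<phi> Q" "\<phi> \<in> extensional Q"
  using injective_homs[OF assms(1,2)] assms(3) by (auto simp: mon_def)

lemma F_closed:
  assumes "subgroup Q P" "subgroup R P" "\<phi> \<in> F Q R" "x \<in> Q"
  shows "\<phi> x \<in> R"
  using F_hom(1)[OF assms(1-3)] assms(4) by (auto simp: hom_def)

lemma F_mult:
  assumes "subgroup Q P" "subgroup R P" "\<phi> \<in> F Q R" "x \<in> Q" "y \<in> Q"
  shows "\<phi> (x \<otimes> y) = \<phi> x \<otimes> \<phi> y"
  using F_hom(1)[OF assms(1-3)] assms(4,5) by (auto simp: hom_def)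

lemma subgroup_F_image:
  assumes Q: "subgroup Q P" and R: "subgroup R P" and "\<phi> \<in> F Q R"
  shows "subgroup (\<phi> ` Q) P"
proof -
  have "group_hom (P\<lparr>carrier := Q\<rparr>) (P\<lparr>carrier := R\<rparr>) \<phi>"
    using F_hom(1)[OF assms] subgroup_imp_group Q R
    by (simp add: group_hom_def group_hom_axioms_def)
  then have "subgroup (\<phi> ` Q) (P\<lparr>carrier := R\<rparr>)"
    using group_hom.img_is_subgroup by fastforce
  then show ?thesis using incl_subgroup[OF R] by blast
qed

lemma inclusion_mem_F:
  assumes Q: "subgroup Q P" and R: "subgroup R P" and "Q \<subseteq> R"
  shows "(\<lambda>x\<in>Q. x) \<in> F Q R"
proof -
  have "(\<lambda>x\<in>Q. x) = restrict (conj_by P \<one>) Q"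
    using subgroup.mem_carrier[OF Q] by (intro restrict_ext) simp
  moreover have "conj_by P \<one> ` Q \<subseteq> R"
    using \<open>Q \<subseteq> R\<close> subgroup.mem_carrier[OF Q] by auto
  ultimately have "(\<lambda>x\<in>Q. x) \<in> conj_fusion P Q R"
    unfolding conj_fusion_def by (intro CollectI exI[of _ \<one>]) simp
  then show ?thesis using conj_morphisms[OF Q R] by blast
qed

text \<open>A morphism is an isomorphism onto its image followed by an inclusion, and inclusions are
  morphisms since they are conjugation by one.\<close>

lemma F_codomain:
  assumes Q: "subgroup Q P" and R: "subgroup R P" and T: "subgroup T P"
    and \<phi>: "\<phi> \<in> F Q R" and sub: "\<phi> ` Q \<subseteq> T"
  shows "\<phi> \<in> F Q T"
proof -
  have im: "subgroup (\<phi> ` Q) P" by (rule subgroup_F_image[OF Q R \<phi>])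
  have "\<phi> \<in> F Q (\<phi> ` Q)" using iso_onto_image[OF Q R \<phi>] by blast
  then have "compose Q (\<lambda>x\<in>\<phi> ` Q. x) \<phi> \<in> F Q T"
    using compose_morphisms[OF Q im T] inclusion_mem_F[OF im T sub] by blast
  moreover have "compose Q (\<lambda>x\<in>\<phi> ` Q. x) \<phi> = \<phi>"
    using F_hom(3)[OF Q R \<phi>] by (auto simp: compose_def extensional_def)
  ultimately show ?thesis by simp
qed

lemma F_restrict:
  assumes Q: "subgroup Q P" and R: "subgroup R P" and T: "subgroup T P"
    and \<phi>: "\<phi> \<in> F R T" and sub: "Q \<subseteq> R"
  shows "restrict \<phi> Q \<in> F Q T"
proof -
  have "compose Q \<phi> (\<lambda>x\<in>Q. x) \<in> F Q T"
    using compose_morphisms[OF Q R T inclusion_mem_F[OF Q R sub] \<phi>] .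
  moreover have "compose Q \<phi> (\<lambda>x\<in>Q. x) = restrict \<phi> Q"
    by (auto simp: compose_def)
  ultimately show ?thesis by simp
qed

lemma F_self_image:
  assumes "finite (carrier P)" "subgroup Q P" "\<phi> \<in> F Q Q"
  shows "\<phi> ` Q = Q"
  using endo_inj_surj[of Q \<phi>] F_closed[OF assms(2,2,3)] F_hom(2)[OF assms(2,2,3)]
    finite_subset[OF subgroup.subset[OF assms(2)] assms(1)] by blast

lemma F_self_Bij:
  assumes "finite (carrier P)" "subgroup Q P" "\<phi> \<in> F Q Q"
  shows "\<phi> \<in> Bij Q"
  using F_self_image[OF assms] F_hom[OF assms(2,2,3)] by (simp add: Bij_def bij_betw_def)

lemma subgroup_F_self:
  assumes fin: "finite (carrier P)" and Q: "subgroup Q P"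
  shows "subgroup (F Q Q) (BijGroup Q)"
proof
  show "F Q Q \<subseteq> carrier (BijGroup Q)"
    using F_self_Bij[OF fin Q] by (auto simp: BijGroup_def)
  show "\<one>\<^bsub>BijGroup Q\<^esub> \<in> F Q Q"
    using inclusion_mem_F[OF Q Q] by (simp add: BijGroup_def)
  show "\<phi> \<otimes>\<^bsub>BijGroup Q\<^esub> \<psi> \<in> F Q Q" if "\<phi> \<in> F Q Q" "\<psi> \<in> F Q Q" for \<phi> \<psi>
    using compose_morphisms[OF Q Q Q that(2,1)] that F_self_Bij[OF fin Q]
    by (simp add: BijGroup_def)
  show "inv\<^bsub>BijGroup Q\<^esub> \<phi> \<in> F Q Q" if "\<phi> \<in> F Q Q" for \<phi>
    using iso_onto_image[OF Q Q that] F_self_image[OF fin Q that] inv_BijGroup[OF F_self_Bij[OF fin Q that]]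
    by simp
qed

lemma BijGroup_mult_apply:
  assumes "finite (carrier P)" "subgroup Q P" "\<phi> \<in> F Q Q" "\<psi> \<in> F Q Q" "x \<in> Q"
  shows "(\<phi> \<otimes>\<^bsub>BijGroup Q\<^esub> \<psi>) x = \<phi> (\<psi> x)"
  using F_self_Bij[OF assms(1-3)] F_self_Bij[OF assms(1,2,4)] assms(5)
  by (simp add: BijGroup_def compose_def)

end

lemma (in group) conj_by_eq_self_iff:
  "\<lbrakk>g \<in> carrier G; x \<in> carrier G\<rbrakk> \<Longrightarrow> conj_by G g x = x \<longleftrightarrow> x \<otimes> g = g \<otimes> x"
  by (simp add: conj_by_def m_assoc inv_solve_left')

lemma (in group) sylow_index_not_dvd:
  assumes p: "Factorial_Ring.prime p" and fin: "finite (carrier G)" and S: "sylow_subgroup p G S"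
  shows "\<not> p dvd order (G Mod S)"
proof
  assume "p dvd order (G Mod S)"
  moreover have "order (G Mod S) * card S = order G" "card S = p ^ multiplicity p (order G)"
    using S lagrange[of S] by (simp_all add: sylow_subgroup_def order_def FactGroup_def)
  ultimately have "p ^ Suc (multiplicity p (order G)) dvd order G"
    by (metis mult_dvd_mono dvd_refl power_Suc)
  moreover have "order G > 0" using fin order_gt_0_iff_finite by blast
  ultimately show False
    using power_dvd_iff_le_multiplicity[of "order G" p "Suc (multiplicity p (order G))"]
      prime_gt_1_nat[OF p] by auto
qed

text \<open>The holomorph construction: \<open>P \<rtimes> H\<close> is the group of the permutations
  \<open>x \<mapsto> a \<alpha>(x)\<close> of \<open>P\<close> with \<open>a \<in> P\<close> and \<open>\<alpha> \<in> H\<close>.\<close>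

definition left_translation :: "('a, 'b) monoid_scheme \<Rightarrow> 'a \<Rightarrow> 'a \<Rightarrow> 'a" where
  "left_translation P a = (\<lambda>x\<in>carrier P. a \<otimes>\<^bsub>P\<^esub> x)"

lemma (in group) left_translation_Bij:
  "a \<in> carrier G \<Longrightarrow> left_translation G a \<in> Bij (carrier G)"
  using surj_const_mult[of a] inj_on_cmult[of a]
  by (simp add: left_translation_def Bij_def bij_betw_def inj_on_def)

text \<open>By \<open>extends\<close>, F consists of the restrictions of elements of A = Aut_F(P).
  The inner automorphisms N are abelian because commutators are central, and are a normal Sylow
  subgroup, so A = N H. In G = L H, with L the left translations, conjugation on L induces exactly
  the products of elements of H with inner automorphisms, that is, all of A.\<close>

lemma (in fusion_system) semidirect_fusion_if_extends:
  assumes p: "Factorial_Ring.prime p" and P: "finite_p_group p P"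
    and sylow: "sylow_subgroup p (Aut_grp F (carrier P)) (conj_fusion P (carrier P) (carrier P))"
    and central: "\<And>x y. x \<in> carrier P \<Longrightarrow> y \<in> carrier P \<Longrightarrow> \<exists>z\<in>center P. x \<otimes> y = z \<otimes> (y \<otimes> x)"
    and extends: "\<And>Q \<phi>. subgroup Q P \<Longrightarrow> \<phi> \<in> F Q (carrier P) \<Longrightarrow>
      \<exists>\<beta>\<in>F (carrier P) (carrier P). \<forall>x\<in>Q. \<phi> x = \<beta> x"
  shows "semidirect_fusion p P F"
proof -
  have fin: "finite (carrier P)" using P by (simp add: finite_p_group_def)
  have sP: "subgroup (carrier P) P" by (rule subgroup_self)
  define B where "B = BijGroup (carrier P)"
  define A where "A = F (carrier P) (carrier P)"
  define c where "c g = restrict (conj_by P g) (carrier P)" for g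
  define N where "N = c ` carrier P"
  define l where "l = left_translation P"
  interpret B: group B unfolding B_def by (rule group_BijGroup)
  have car_B: "carrier B = Bij (carrier P)" by (simp add: B_def BijGroup_def)
  have B_apply: "(\<alpha> \<otimes>\<^bsub>B\<^esub> \<beta>) x = \<alpha> (\<beta> x)"
    if "\<alpha> \<in> carrier B" "\<beta> \<in> carrier B" "x \<in> carrier P" for \<alpha> \<beta> x
    using that by (simp add: B_def BijGroup_def compose_def)
  have B_one: "\<one>\<^bsub>B\<^esub> = (\<lambda>x\<in>carrier P. x)" by (simp add: B_def BijGroup_def)
  have B_eqI: "\<alpha> = \<beta>"
    if "\<alpha> \<in> carrier B" "\<beta> \<in> carrier B" "\<And>x. x \<in> carrier P \<Longrightarrow> \<alpha> x = \<beta> x" for \<alpha> \<beta>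
    using that Bij_imp_extensional[of \<alpha> "carrier P"] Bij_imp_extensional[of \<beta> "carrier P"]
    unfolding car_B by (metis extensionalityI)
  have A: "subgroup A B" unfolding A_def B_def by (rule subgroup_F_self[OF fin sP])
  have A_B: "\<alpha> \<in> carrier B" if "\<alpha> \<in> A" for \<alpha> using that subgroup.mem_carrier[OF A] by blast
  have A_closed: "\<alpha> x \<in> carrier P" if "\<alpha> \<in> A" "x \<in> carrier P" for \<alpha> x
    using F_closed[OF sP sP] that by (simp add: A_def)
  have A_mult: "\<alpha> (x \<otimes> y) = \<alpha> x \<otimes> \<alpha> y" if "\<alpha> \<in> A" "x \<in> carrier P" "y \<in> carrier P" for \<alpha> x y
    using F_mult[OF sP sP] that by (simp add: A_def)
  have A_hom: "group_hom P P \<alpha>" if "\<alpha> \<in> A" for \<alpha>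
    using A_closed A_mult that by (simp add: group_hom_def group_hom_axioms_def is_group hom_def)
  have A_one: "\<alpha> \<one> = \<one>" if "\<alpha> \<in> A" for \<alpha> using group_hom.hom_one[OF A_hom[OF that]] .
  have A_inv: "\<alpha> (inv x) = inv (\<alpha> x)" if "\<alpha> \<in> A" "x \<in> carrier P" for \<alpha> x
    using group_hom.hom_inv[OF A_hom[OF that(1)] that(2)] .
  have A_inv_closed: "inv\<^bsub>B\<^esub> \<alpha> \<in> A" if "\<alpha> \<in> A" for \<alpha>
    using subgroup.m_inv_closed[OF A that] .
  define AG where "AG = B\<lparr>carrier := A\<rparr>"
  interpret AG: group AG unfolding AG_def by (rule B.subgroup_imp_group[OF A])
  have N_eq: "N = conj_fusion P (carrier P) (carrier P)"
    unfolding N_def c_def by (simp add: conj_fusion_self_eq)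
  have AG_eq: "AG = Aut_grp F (carrier P)" by (simp add: AG_def B_def A_def Aut_grp_def)
  have N_sub: "subgroup N AG" and N_card: "card N = p ^ multiplicity p (order AG)"
    using sylow unfolding N_eq AG_eq by (auto simp: sylow_subgroup_def)
  have NA: "c g \<in> A" if "g \<in> carrier P" for g
    using subgroup.subset[OF N_sub] that by (auto simp: AG_def N_def)
  have c_conj: "\<alpha> \<otimes>\<^bsub>B\<^esub> c g = c (\<alpha> g) \<otimes>\<^bsub>B\<^esub> \<alpha>" if "\<alpha> \<in> A" "g \<in> carrier P" for \<alpha> g
    using that NA A_B A_closed
    by (intro B_eqI) (simp_all add: B_apply c_def conj_by_def A_mult A_inv)
  have N_normal: "N \<lhd> AG"
  proof -
    have "\<alpha> \<otimes>\<^bsub>AG\<^esub> x \<otimes>\<^bsub>AG\<^esub> inv\<^bsub>AG\<^esub> \<alpha> \<in> N" if asm: "\<alpha> \<in> carrier AG" "x \<in> N" for \<alpha> x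
    proof -
      have \<alpha>: "\<alpha> \<in> A" using asm by (simp add: AG_def)
      obtain g where g: "g \<in> carrier P" "x = c g" using asm by (auto simp: N_def)
      have "\<alpha> \<otimes>\<^bsub>AG\<^esub> x = c (\<alpha> g) \<otimes>\<^bsub>AG\<^esub> \<alpha>" using c_conj[OF \<alpha> g(1)] g(2) by (simp add: AG_def)
      moreover have "c (\<alpha> g) \<in> carrier AG" using NA A_closed \<alpha> g by (simp add: AG_def)
      ultimately have "\<alpha> \<otimes>\<^bsub>AG\<^esub> x \<otimes>\<^bsub>AG\<^esub> inv\<^bsub>AG\<^esub> \<alpha> = c (\<alpha> g)"
        using asm(1) by (simp add: AG.m_assoc)
      then show ?thesis using A_closed \<alpha> g by (simp add: N_def)
    qed
    then show ?thesis using AG.normal_inv_iff N_sub by blast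
  qed
  have N_comm: "x \<otimes>\<^bsub>AG\<^esub> y = y \<otimes>\<^bsub>AG\<^esub> x" if xy: "x \<in> N" "y \<in> N" for x y
  proof -
    obtain g h where g: "g \<in> carrier P" "x = c g" and h: "h \<in> carrier P" "y = c h"
      using xy by (auto simp: N_def)
    obtain z where z: "z \<in> center P" "h \<otimes> g = z \<otimes> (g \<otimes> h)" using central[OF h(1) g(1)] by blast
    have zP: "z \<in> carrier P" and z_comm: "\<And>u. u \<in> carrier P \<Longrightarrow> z \<otimes> u = u \<otimes> z"
      using z(1) by (auto simp: centraliser_def)
    \<comment> \<open>The two products of g and h differ by the central z, so they induce the same
      inner automorphism.\<close>
    have "conj_by P z u = u" if "u \<in> carrier P" for u
      using z_comm[OF that] zP that conj_by_eq_self_iff by simp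
    then have "conj_by P (h \<otimes> g) u = conj_by P (g \<otimes> h) u" if "u \<in> carrier P" for u
      using that zP g(1) h(1) conj_by_conj_by[of "g \<otimes> h" z u] z(2) by simp
    then have "x \<otimes>\<^bsub>B\<^esub> y = y \<otimes>\<^bsub>B\<^esub> x"
      using g h NA A_B by (intro B_eqI) (simp_all add: B_apply c_def conj_by_conj_by)
    then show ?thesis by (simp add: AG_def)
  qed
  have AG_fin: "finite (carrier AG)"
  proof -
    have "A \<subseteq> carrier P \<rightarrow>\<^sub>E carrier P"
      using A_closed F_hom(3)[OF sP sP] by (auto simp: A_def PiE_def extensional_def)
    then show ?thesis
      using finite_subset finite_PiE[OF fin, of "\<lambda>_. carrier P"] fin by (auto simp: AG_def)
  qed
  have not_dvd: "\<not> p dvd order (AG Mod N)"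
    using AG.sylow_index_not_dvd[OF p AG_fin] sylow by (simp add: N_eq AG_eq)
  have "coprime (card N) (order (AG Mod N))"
    using prime_imp_coprime[OF p not_dvd] N_card by simp
  then obtain H where semi: "internal_semidirect AG N H"
    using AG.abelian_normal_complement[OF N_normal AG_fin N_comm] by blast
  have H_sub: "subgroup H AG" and NH: "N <#>\<^bsub>AG\<^esub> H = A"
    using semi by (auto simp: internal_semidirect_def AG_def)
  have H: "subgroup H B" using B.incl_subgroup[OF A] H_sub by (simp add: AG_def)
  have HA: "\<alpha> \<in> A" if "\<alpha> \<in> H" for \<alpha> using subgroup.subset[OF H_sub] that by (auto simp: AG_def)
  have H_card: "\<not> p dvd card H"
    using AG.internal_semidirect_order_Mod[OF semi] not_dvd by simp
  have l_B: "l a \<in> carrier B" if "a \<in> carrier P" for a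
    using left_translation_Bij[OF that] by (simp add: l_def car_B)
  have l_apply: "l a x = a \<otimes> x" if "x \<in> carrier P" for a x
    using that by (simp add: l_def left_translation_def)
  have l_mult: "l a \<otimes>\<^bsub>B\<^esub> l b = l (a \<otimes> b)" if "a \<in> carrier P" "b \<in> carrier P" for a b
    using that l_B by (intro B_eqI) (simp_all add: B_apply l_apply m_assoc)
  have l_one: "l \<one> = \<one>\<^bsub>B\<^esub>"
    by (rule B_eqI[OF l_B[OF one_closed] B.one_closed]) (simp add: l_apply B_one)
  have l_inv: "inv\<^bsub>B\<^esub> (l a) = l (inv a)" if "a \<in> carrier P" for a
    using that l_mult[of "inv a" a] l_one l_B by (intro B.inv_equality) simp_all
  have l_eqD: "a = b" if "l a = l b" "a \<in> carrier P" "b \<in> carrier P" for a b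
    using that l_apply[OF one_closed] by (metis r_one)
  \<comment> \<open>The commutation rule of the holomorph. It makes K = L H closed under products
    and inverses and underlies the conjugation formula \<open>K_conj\<close>.\<close>
  have A_l: "\<alpha> \<otimes>\<^bsub>B\<^esub> l a = l (\<alpha> a) \<otimes>\<^bsub>B\<^esub> \<alpha>" if "\<alpha> \<in> A" "a \<in> carrier P" for \<alpha> a
    using that A_B l_B A_closed by (intro B_eqI) (simp_all add: B_apply l_apply A_mult)
  define L where "L = l ` carrier P"
  have L: "subgroup L B"
  proof (rule B.subgroupI)
    show "L \<subseteq> carrier B" using l_B by (auto simp: L_def)
    show "L \<noteq> {}" using one_closed by (auto simp: L_def)
    show "inv\<^bsub>B\<^esub> x \<in> L" if "x \<in> L" for x using that l_inv by (auto simp: L_def)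
    show "x \<otimes>\<^bsub>B\<^esub> y \<in> L" if "x \<in> L" "y \<in> L" for x y
      using that l_mult by (auto simp: L_def)
  qed
  define K where "K = L <#>\<^bsub>B\<^esub> H"
  have K_iff: "x \<in> K \<longleftrightarrow> (\<exists>a\<in>carrier P. \<exists>\<alpha>\<in>H. x = l a \<otimes>\<^bsub>B\<^esub> \<alpha>)" for x
    by (auto simp: K_def L_def set_mult_def)
  have K: "subgroup K B"
  proof (rule B.subgroupI)
    show "K \<subseteq> carrier B" using l_B HA A_B by (auto simp: K_iff)
    show "K \<noteq> {}"
      using one_closed subgroup.one_closed[OF H] K_iff by blast
    show "inv\<^bsub>B\<^esub> x \<in> K" if x: "x \<in> K" for x
    proof -
      obtain a \<alpha> where a: "a \<in> carrier P" "\<alpha> \<in> H" "x = l a \<otimes>\<^bsub>B\<^esub> \<alpha>" using x K_iff by blast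
      have i: "inv\<^bsub>B\<^esub> \<alpha> \<in> H" using subgroup.m_inv_closed[OF H a(2)] .
      have "inv\<^bsub>B\<^esub> x = inv\<^bsub>B\<^esub> \<alpha> \<otimes>\<^bsub>B\<^esub> l (inv a)"
        using a l_B HA A_B l_inv by (simp add: B.inv_mult_group)
      also have "\<dots> = l ((inv\<^bsub>B\<^esub> \<alpha>) (inv a)) \<otimes>\<^bsub>B\<^esub> inv\<^bsub>B\<^esub> \<alpha>"
        using A_l[OF HA[OF i]] a(1) by simp
      finally show ?thesis using i a(1) A_closed[OF HA[OF i]] K_iff by blast
    qed
    show "x \<otimes>\<^bsub>B\<^esub> y \<in> K" if xy: "x \<in> K" "y \<in> K" for x y
    proof -
      obtain a \<alpha> where a: "a \<in> carrier P" "\<alpha> \<in> H" "x = l a \<otimes>\<^bsub>B\<^esub> \<alpha>" using xy K_iff by blast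
      obtain b \<beta> where b: "b \<in> carrier P" "\<beta> \<in> H" "y = l b \<otimes>\<^bsub>B\<^esub> \<beta>" using xy K_iff by blast
      have cs: "l a \<in> carrier B" "l b \<in> carrier B" "\<alpha> \<in> carrier B" "\<beta> \<in> carrier B"
          "l (\<alpha> b) \<in> carrier B" "\<alpha> b \<in> carrier P"
        using a b l_B HA A_B A_closed by auto
      have "x \<otimes>\<^bsub>B\<^esub> y = l a \<otimes>\<^bsub>B\<^esub> (\<alpha> \<otimes>\<^bsub>B\<^esub> l b) \<otimes>\<^bsub>B\<^esub> \<beta>"
        using cs a(3) b(3) by (simp add: B.m_assoc)
      also have "\<dots> = (l a \<otimes>\<^bsub>B\<^esub> l (\<alpha> b)) \<otimes>\<^bsub>B\<^esub> (\<alpha> \<otimes>\<^bsub>B\<^esub> \<beta>)"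
        using cs A_l[OF HA[OF a(2)] b(1)] by (simp add: B.m_assoc)
      also have "l a \<otimes>\<^bsub>B\<^esub> l (\<alpha> b) = l (a \<otimes> \<alpha> b)" using l_mult a(1) cs by simp
      finally show ?thesis
        using K_iff subgroup.m_closed[OF H a(2) b(2)] m_closed[OF a(1) cs(6)] by blast
    qed
  qed
  define G where "G = B\<lparr>carrier := K\<rparr>"
  interpret G: group G unfolding G_def by (rule B.subgroup_imp_group[OF K])
  have LK: "L \<subseteq> K" using subgroup.one_closed[OF H] l_B by (auto simp: L_def K_iff) (metis B.r_one)
  have HK: "H \<subseteq> K"
  proof
    fix \<alpha> assume "\<alpha> \<in> H"
    then show "\<alpha> \<in> K" using l_one one_closed K_iff A_B HA B.l_one by metis
  qed
  have G_inv: "inv\<^bsub>G\<^esub> x = inv\<^bsub>B\<^esub> x" if "x \<in> K" for x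
    using B.m_inv_consistent[OF K that] by (simp add: G_def)
  \<comment> \<open>Conjugation by l a \<alpha> acts on the translations as conjugation by a
    followed by the inverse of \<alpha>; the inverse comes from the right action.\<close>
  have K_conj: "conj_by G (l a \<otimes>\<^bsub>B\<^esub> \<alpha>) (l x) = l ((inv\<^bsub>B\<^esub> \<alpha>) (conj_by P a x))"
    if a: "a \<in> carrier P" and \<alpha>: "\<alpha> \<in> H" and x: "x \<in> carrier P" for a \<alpha> x
  proof -
    have i: "inv\<^bsub>B\<^esub> \<alpha> \<in> H" using subgroup.m_inv_closed[OF H \<alpha>] .
    have cs: "l a \<in> carrier B" "\<alpha> \<in> carrier B" "inv\<^bsub>B\<^esub> \<alpha> \<in> carrier B" "l x \<in> carrier B"
        "l (inv a) \<in> carrier B" "conj_by P a x \<in> carrier P"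
        "l (conj_by P a x) \<in> carrier B" "l ((inv\<^bsub>B\<^esub> \<alpha>) (conj_by P a x)) \<in> carrier B"
      using a x l_B HA[OF \<alpha>] HA[OF i] A_B A_closed by auto
    have "l a \<otimes>\<^bsub>B\<^esub> \<alpha> \<in> K" using a \<alpha> K_iff by blast
    then have "conj_by G (l a \<otimes>\<^bsub>B\<^esub> \<alpha>) (l x) = inv\<^bsub>B\<^esub> (l a \<otimes>\<^bsub>B\<^esub> \<alpha>) \<otimes>\<^bsub>B\<^esub> l x \<otimes>\<^bsub>B\<^esub> (l a \<otimes>\<^bsub>B\<^esub> \<alpha>)"
      using G_inv by (simp add: conj_by_def G_def)
    also have "\<dots> = inv\<^bsub>B\<^esub> \<alpha> \<otimes>\<^bsub>B\<^esub> (l (inv a) \<otimes>\<^bsub>B\<^esub> l x \<otimes>\<^bsub>B\<^esub> l a) \<otimes>\<^bsub>B\<^esub> \<alpha>"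
      using cs a l_inv by (simp add: B.inv_mult_group B.m_assoc)
    also have "l (inv a) \<otimes>\<^bsub>B\<^esub> l x \<otimes>\<^bsub>B\<^esub> l a = l (conj_by P a x)"
      using a x l_mult by (simp add: conj_by_def)
    also have "inv\<^bsub>B\<^esub> \<alpha> \<otimes>\<^bsub>B\<^esub> l (conj_by P a x) = l ((inv\<^bsub>B\<^esub> \<alpha>) (conj_by P a x)) \<otimes>\<^bsub>B\<^esub> inv\<^bsub>B\<^esub> \<alpha>"
      using A_l[OF HA[OF i] cs(6)] .
    also have "\<dots> \<otimes>\<^bsub>B\<^esub> \<alpha> = l ((inv\<^bsub>B\<^esub> \<alpha>) (conj_by P a x))"
      using cs by (simp add: B.m_assoc)
    finally show ?thesis .
  qed
  have "internal_semidirect G L H"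
    unfolding internal_semidirect_def
  proof (intro conjI)
    have LG: "subgroup L G" unfolding G_def by (rule B.subgroup_incl[OF L K LK])
    show "subgroup H G" unfolding G_def by (rule B.subgroup_incl[OF H K HK])
    have "x \<otimes>\<^bsub>G\<^esub> s \<otimes>\<^bsub>G\<^esub> inv\<^bsub>G\<^esub> x \<in> L" if x: "x \<in> carrier G" and s: "s \<in> L" for x s
    proof -
      obtain a \<alpha> where a: "a \<in> carrier P" "\<alpha> \<in> H" "inv\<^bsub>G\<^esub> x = l a \<otimes>\<^bsub>B\<^esub> \<alpha>"
        using G.inv_closed[OF x] K_iff by (auto simp: G_def)
      obtain y where y: "y \<in> carrier P" "s = l y" using s by (auto simp: L_def)
      have "x \<otimes>\<^bsub>G\<^esub> s \<otimes>\<^bsub>G\<^esub> inv\<^bsub>G\<^esub> x = conj_by G (inv\<^bsub>G\<^esub> x) s"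
        using x by (simp add: conj_by_def)
      also have "\<dots> = l ((inv\<^bsub>B\<^esub> \<alpha>) (conj_by P a y))" using K_conj a y by simp
      finally show ?thesis
        using A_closed HA subgroup.m_inv_closed[OF H a(2)] a(1) y(1) by (simp add: L_def)
    qed
    then show "L \<lhd> G" using G.normal_inv_iff LG by blast
    show "L <#>\<^bsub>G\<^esub> H = carrier G" by (simp add: G_def K_def)
    \<comment> \<open>Elements of H are automorphisms and fix the identity of P, but the translation
      by a sends the identity to a.\<close>
    show "L \<inter> H = {\<one>\<^bsub>G\<^esub>}"
    proof (intro equalityI subsetI)
      fix x assume "x \<in> L \<inter> H"
      then obtain a where a: "a \<in> carrier P" "x = l a" "l a \<in> A" using HA by (auto simp: L_def)
      then have "a = \<one>" using A_one[OF a(3)] l_apply[OF one_closed, of a] by simp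
      then show "x \<in> {\<one>\<^bsub>G\<^esub>}" using a l_one by (simp add: G_def)
    next
      fix x assume "x \<in> {\<one>\<^bsub>G\<^esub>}"
      then show "x \<in> L \<inter> H"
        using subgroup.one_closed[OF L] subgroup.one_closed[OF H] by (simp add: G_def)
    qed
  qed
  moreover have "l \<in> iso P (G\<lparr>carrier := L\<rparr>)"
    using l_eqD l_mult by (auto simp: iso_def hom_def bij_betw_def inj_on_def G_def L_def)
  moreover have "finite (carrier G)"
  proof -
    have "finite H" using finite_subset[OF subgroup.subset[OF H_sub] AG_fin] .
    then have "finite ((\<lambda>(a, \<alpha>). l a \<otimes>\<^bsub>B\<^esub> \<alpha>) ` (carrier P \<times> H))" using fin by blast
    moreover have "K = (\<lambda>(a, \<alpha>). l a \<otimes>\<^bsub>B\<^esub> \<alpha>) ` (carrier P \<times> H)" using K_iff by auto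
    ultimately show ?thesis by (simp add: G_def)
  qed
  moreover have "F Q R = {\<phi> \<in> Q \<rightarrow>\<^sub>E R. \<exists>m\<in>carrier G. \<forall>x\<in>Q. l (\<phi> x) = conj_by G m (l x)}"
    if Q: "subgroup Q P" and R: "subgroup R P" for Q R
  proof (intro equalityI subsetI CollectI conjI)
    have QP: "x \<in> carrier P" if "x \<in> Q" for x using subgroup.mem_carrier[OF Q that] .
    fix \<phi> assume \<phi>: "\<phi> \<in> F Q R"
    show "\<phi> \<in> Q \<rightarrow>\<^sub>E R" using F_closed[OF Q R \<phi>] F_hom(3)[OF Q R \<phi>] by (simp add: PiE_iff)
    have "\<phi> ` Q \<subseteq> carrier P" using F_closed[OF Q R \<phi>] subgroup.mem_carrier[OF R] by blast
    then obtain \<beta> where \<beta>: "\<beta> \<in> A" "\<forall>x\<in>Q. \<phi> x = \<beta> x"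
      using extends[OF Q F_codomain[OF Q R sP \<phi>]] by (auto simp: A_def)
    \<comment> \<open>The inverse of \<beta> is decomposed instead of \<beta>, so that \<beta>
      becomes the inverse of \<alpha> after an inner automorphism, the order of factors that
      \<open>K_conj\<close> produces.\<close>
    have "inv\<^bsub>B\<^esub> \<beta> \<in> N <#>\<^bsub>B\<^esub> H" using NH A_inv_closed[OF \<beta>(1)] by (simp add: AG_def)
    then obtain g \<alpha> where g: "g \<in> carrier P" and \<alpha>: "\<alpha> \<in> H" and g\<alpha>: "inv\<^bsub>B\<^esub> \<beta> = c g \<otimes>\<^bsub>B\<^esub> \<alpha>"
      by (auto simp: N_def set_mult_def)
    have i: "inv\<^bsub>B\<^esub> \<alpha> \<in> H" using subgroup.m_inv_closed[OF H \<alpha>] .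
    have ci: "c g \<otimes>\<^bsub>B\<^esub> c (inv g) = \<one>\<^bsub>B\<^esub>"
      using NA[OF g] NA[of "inv g"] g A_B
      by (intro B_eqI[OF B.m_closed B.one_closed]) (simp_all add: B_apply c_def conj_by_conj_by B_one)
    have cs: "c g \<in> carrier B" "c (inv g) \<in> carrier B" "\<alpha> \<in> carrier B" "inv\<^bsub>B\<^esub> \<alpha> \<in> carrier B" "\<beta> \<in> carrier B"
      using NA A_B g HA[OF \<alpha>] HA[OF i] \<beta>(1) by simp_all
    have "inv\<^bsub>B\<^esub> (c g) = c (inv g)"
      using B.inv_equality[of "c (inv g)" "c g"] B.inv_comm[OF ci] cs by simp
    then have "\<beta> = inv\<^bsub>B\<^esub> \<alpha> \<otimes>\<^bsub>B\<^esub> c (inv g)"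
      using g\<alpha> cs B.inv_mult_group[of "c g" \<alpha>] B.inv_inv[of \<beta>] by simp
    then have "\<beta> x = (inv\<^bsub>B\<^esub> \<alpha>) (conj_by P (inv g) x)" if "x \<in> Q" for x
      using B_apply cs QP[OF that] by (simp add: c_def)
    then have "\<forall>x\<in>Q. l (\<phi> x) = conj_by G (l (inv g) \<otimes>\<^bsub>B\<^esub> \<alpha>) (l x)"
      using \<beta>(2) K_conj[OF inv_closed[OF g] \<alpha>] QP by simp
    moreover have "l (inv g) \<otimes>\<^bsub>B\<^esub> \<alpha> \<in> carrier G" using g \<alpha> K_iff inv_closed by (auto simp: G_def)
    ultimately show "\<exists>m\<in>carrier G. \<forall>x\<in>Q. l (\<phi> x) = conj_by G m (l x)" by blast
  next
    have QP: "x \<in> carrier P" if "x \<in> Q" for x using subgroup.mem_carrier[OF Q that] .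
    fix \<phi> assume "\<phi> \<in> {\<phi> \<in> Q \<rightarrow>\<^sub>E R. \<exists>m\<in>carrier G. \<forall>x\<in>Q. l (\<phi> x) = conj_by G m (l x)}"
    then obtain m where \<phi>: "\<phi> \<in> Q \<rightarrow>\<^sub>E R" and m: "m \<in> carrier G" "\<forall>x\<in>Q. l (\<phi> x) = conj_by G m (l x)"
      by blast
    obtain a \<alpha> where a: "a \<in> carrier P" and \<alpha>: "\<alpha> \<in> H" and m_eq: "m = l a \<otimes>\<^bsub>B\<^esub> \<alpha>"
      using m(1) K_iff by (auto simp: G_def)
    have i: "inv\<^bsub>B\<^esub> \<alpha> \<in> H" using subgroup.m_inv_closed[OF H \<alpha>] .
    define \<beta> where "\<beta> = inv\<^bsub>B\<^esub> \<alpha> \<otimes>\<^bsub>B\<^esub> c a"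
    have \<beta>: "\<beta> \<in> F (carrier P) (carrier P)"
      using subgroup.m_closed[OF A HA[OF i] NA[OF a]] by (simp add: \<beta>_def A_def)
    have \<phi>_eq: "\<phi> x = \<beta> x" if x: "x \<in> Q" for x
    proof -
      have "l (\<phi> x) = l ((inv\<^bsub>B\<^esub> \<alpha>) (conj_by P a x))"
        using m(2) x K_conj[OF a \<alpha> QP[OF x]] by (simp add: m_eq)
      moreover have "\<phi> x \<in> carrier P" using \<phi> x subgroup.mem_carrier[OF R] by auto
      moreover have "(inv\<^bsub>B\<^esub> \<alpha>) (conj_by P a x) \<in> carrier P"
        using A_closed[OF HA[OF i]] a QP[OF x] by simp
      ultimately have "\<phi> x = (inv\<^bsub>B\<^esub> \<alpha>) (conj_by P a x)" using l_eqD by blast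
      then show ?thesis
        using B_apply A_B HA[OF i] NA[OF a] QP[OF x] by (simp add: \<beta>_def c_def)
    qed
    then have "\<phi> = restrict \<beta> Q"
      using \<phi> by (auto simp: PiE_def extensional_def)
    then have "\<phi> \<in> F Q (carrier P)"
      using F_restrict[OF Q sP sP \<beta>] subgroup.subset[OF Q] by simp
    then show "\<phi> \<in> F Q R"
      using F_codomain[OF Q sP R] \<phi> by (auto simp: PiE_iff)
  qed
  ultimately have "realised_by p P F G L H l"
    unfolding realised_by_iff using G.is_group H_card by simp
  then show ?thesis by (rule semidirect_fusion_if_realised_by[OF is_group])
qed

section \<open>Extraspecial groups of order $p^3$\<close>

lemma (in group) subgroup_centraliser:
  assumes "Q \<subseteq> carrier G"
  shows "subgroup (centraliser G Q) G"
proof (rule subgroupI)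
  show "centraliser G Q \<subseteq> carrier G" by (auto simp: centraliser_def)
  show "centraliser G Q \<noteq> {}"
    using assms by (auto simp: centraliser_def subset_iff intro!: exI[of _ \<one>])
next
  fix g assume g: "g \<in> centraliser G Q"
  have "inv g \<otimes> x = x \<otimes> inv g" if "x \<in> Q" for x
  proof -
    have gx: "g \<in> carrier G" "x \<in> carrier G" "g \<otimes> x = x \<otimes> g"
      using g that assms by (auto simp: centraliser_def)
    have "inv g \<otimes> x = inv g \<otimes> (x \<otimes> g) \<otimes> inv g"
      using gx(1,2) by (simp add: m_assoc)
    also have "\<dots> = x \<otimes> inv g"
      using gx(1,2) unfolding gx(3)[symmetric] by (simp add: mult_inv_cancel_left)
    finally show ?thesis .
  qed
  then show "inv g \<in> centraliser G Q" using g by (simp add: centraliser_def)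
next
  fix g h assume gh: "g \<in> centraliser G Q" "h \<in> centraliser G Q"
  have "g \<otimes> h \<otimes> x = x \<otimes> (g \<otimes> h)" if "x \<in> Q" for x
  proof -
    have "g \<in> carrier G" "h \<in> carrier G" "x \<in> carrier G" "g \<otimes> x = x \<otimes> g" "h \<otimes> x = x \<otimes> h"
      using gh that assms by (auto simp: centraliser_def)
    then show ?thesis by (metis m_assoc)
  qed
  then show "g \<otimes> h \<in> centraliser G Q" using gh by (simp add: centraliser_def)
qed

lemma centraliser_subset: "centraliser G Q \<subseteq> carrier G"
  by (auto simp: centraliser_def)

lemma normalizer_subset: "normalizer G H \<subseteq> carrier G"
  by (auto simp: normalizer_def stabilizer_def)

text \<open>The extension axiom returns a map on the extender. Knowing that this is a subgroup
  allows it to be classified by order and the map to be extended once more.\<close>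

lemma (in fusion_system) subgroup_extender:
  assumes Q: "subgroup Q P" and R: "subgroup R P" and \<phi>: "\<phi> \<in> F Q R"
  shows "subgroup (extender P Q \<phi>) P"
proof -
  have QP: "Q \<subseteq> carrier P" using subgroup.subset[OF Q] .
  have \<phi>QP: "\<phi> ` Q \<subseteq> carrier P" using subgroup.subset[OF subgroup_F_image[OF Q R \<phi>]] .
  have N: "subgroup (normalizer P Q) P" and N': "subgroup (normalizer P (\<phi> ` Q)) P"
    using normalizer_imp_subgroup QP \<phi>QP by auto
  have NQ: "conj_by P g x \<in> Q" if "g \<in> normalizer P Q" "x \<in> Q" for g x
    using that mem_normalizer_iff[OF QP] by blast
  show ?thesis
  proof (rule subgroupI)
    show "extender P Q \<phi> \<subseteq> carrier P"
      using normalizer_subset[of P Q] by (auto simp: extender_def)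
    have "\<one> \<in> extender P Q \<phi>"
      using subgroup.one_closed[OF N] subgroup.one_closed[OF N'] QP \<phi>QP
      by (auto simp: extender_def subset_iff intro!: bexI[of _ \<one>])
    then show "extender P Q \<phi> \<noteq> {}" by blast
  next
    fix g assume "g \<in> extender P Q \<phi>"
    then obtain h where g: "g \<in> normalizer P Q" and h: "h \<in> normalizer P (\<phi> ` Q)"
      and gh: "\<forall>x\<in>Q. \<phi> (conj_by P g x) = conj_by P h (\<phi> x)"
      by (auto simp: extender_def)
    have gP: "g \<in> carrier P" and hP: "h \<in> carrier P"
      using subgroup.mem_carrier[OF N g] subgroup.mem_carrier[OF N' h] by auto
    have ig: "inv g \<in> normalizer P Q" using subgroup.m_inv_closed[OF N g] .
    have "\<phi> (conj_by P (inv g) x) = conj_by P (inv h) (\<phi> x)" if x: "x \<in> Q" for x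
    proof -
      define y where "y = conj_by P (inv g) x"
      have y: "y \<in> Q" using NQ[OF ig x] by (simp add: y_def)
      have "conj_by P g y = x"
        using gP x QP by (auto simp: y_def conj_by_conj_by)
      then have "\<phi> x = conj_by P h (\<phi> y)" using gh y by metis
      then show ?thesis
        using hP y \<phi>QP by (auto simp: conj_by_conj_by y_def[symmetric])
    qed
    then show "inv g \<in> extender P Q \<phi>"
      using ig subgroup.m_inv_closed[OF N' h] by (auto simp: extender_def)
  next
    fix g g' assume "g \<in> extender P Q \<phi>" "g' \<in> extender P Q \<phi>"
    then obtain h h' where g: "g \<in> normalizer P Q" "g' \<in> normalizer P Q"
      and h: "h \<in> normalizer P (\<phi> ` Q)" "h' \<in> normalizer P (\<phi> ` Q)"
      and gh: "\<forall>x\<in>Q. \<phi> (conj_by P g x) = conj_by P h (\<phi> x)"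
        "\<forall>x\<in>Q. \<phi> (conj_by P g' x) = conj_by P h' (\<phi> x)"
      by (auto simp: extender_def)
    have cs: "g \<in> carrier P" "g' \<in> carrier P" "h \<in> carrier P" "h' \<in> carrier P"
      using g h subgroup.mem_carrier[OF N] subgroup.mem_carrier[OF N'] by auto
    have "\<phi> (conj_by P (g \<otimes> g') x) = conj_by P (h \<otimes> h') (\<phi> x)" if x: "x \<in> Q" for x
    proof -
      have xP: "x \<in> carrier P" "\<phi> x \<in> carrier P" using x QP \<phi>QP by blast+
      have "\<phi> (conj_by P (g \<otimes> g') x) = \<phi> (conj_by P g' (conj_by P g x))"
        using cs xP by (simp add: conj_by_conj_by)
      also have "\<dots> = conj_by P h' (conj_by P h (\<phi> x))"
        using gh x NQ[OF g(1) x] by simp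
      finally show ?thesis using cs xP by (simp add: conj_by_conj_by)
    qed
    then show "g \<otimes> g' \<in> extender P Q \<phi>"
      using subgroup.m_closed[OF N g] subgroup.m_closed[OF N' h] by (auto simp: extender_def)
  qed
qed

text \<open>For g in Q the element \<phi> g is the required partner of g, as \<phi> is a
  homomorphism on Q.\<close>

lemma (in fusion_system) subset_extender:
  assumes Q: "subgroup Q P" and R: "subgroup R P" and \<phi>: "\<phi> \<in> F Q R"
  shows "Q \<subseteq> extender P Q \<phi>"
proof
  fix g assume g: "g \<in> Q"
  have \<phi>Q: "subgroup (\<phi> ` Q) P" using subgroup_F_image[OF Q R \<phi>] .
  have normalizer: "H \<subseteq> normalizer P H" if "subgroup H P" for H
    using subgroup.subset[OF normal_imp_subgroup[OF normal_in_normalizer[OF that]]] by simp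
  interpret h: group_hom "P\<lparr>carrier := Q\<rparr>" "P\<lparr>carrier := R\<rparr>" \<phi>
    using F_hom(1)[OF Q R \<phi>] subgroup_imp_group[OF Q] subgroup_imp_group[OF R]
    by (simp add: group_hom_def group_hom_axioms_def)
  have "\<phi> (inv g) = inv (\<phi> g)"
    using h.hom_inv[of g] g m_inv_consistent[OF Q g] m_inv_consistent[OF R F_closed[OF Q R \<phi> g]] by simp
  then have "\<phi> (conj_by P g x) = conj_by P (\<phi> g) (\<phi> x)" if "x \<in> Q" for x
    using F_mult[OF Q R \<phi>] g that subgroup.m_closed[OF Q] subgroup.m_inv_closed[OF Q]
    by (simp add: conj_by_def)
  then show "g \<in> extender P Q \<phi>"
    using g normalizer[OF Q] normalizer[OF \<phi>Q] by (auto simp: extender_def)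
qed

text \<open>Conjugation by g is trivial on Q, so the identity serves as the partner of g.\<close>

lemma (in group) centraliser_subset_extender:
  assumes Q: "Q \<subseteq> carrier G" and \<phi>Q: "\<phi> ` Q \<subseteq> carrier G"
  shows "centraliser G Q \<subseteq> extender G Q \<phi>"
proof
  fix g assume g: "g \<in> centraliser G Q"
  then have gG: "g \<in> carrier G" by (simp add: centraliser_def)
  have fixed: "conj_by G g x = x" if "x \<in> Q" for x
    using g that Q gG conj_by_eq_self_iff[of g x] by (auto simp: centraliser_def)
  then have "g \<in> normalizer G Q" using mem_normalizer_iff[OF Q] gG by simp
  moreover have "\<one> \<in> normalizer G (\<phi> ` Q)"
    using subgroup.one_closed normalizer_imp_subgroup[OF \<phi>Q] by blast
  ultimately show "g \<in> extender G Q \<phi>"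
    using fixed \<phi>Q by (auto simp: extender_def intro!: bexI[of _ \<one>])
qed

section \<open>Centralisers and normalisers of subgroups of P\<close>

locale extraspecial_cubed = group P for P :: "('a, 'b) monoid_scheme" (structure) +
  fixes p :: nat
  assumes prime_p: "Factorial_Ring.prime p"
    and extraspecial: "extraspecial p P"
    and order_eq: "order P = p ^ 3"
begin

lemma fin: "finite (carrier P)" and p_group: "finite_p_group p P" and card_center: "card (center P) = p"
  and p_gt_1: "1 < p"
  using extraspecial prime_gt_1_nat[OF prime_p] by (auto simp: extraspecial_def finite_p_group_def)

lemma center_commute: "z \<in> center P \<Longrightarrow> x \<in> carrier P \<Longrightarrow> z \<otimes> x = x \<otimes> z"
  by (simp add: centraliser_def)

lemma center_carrier: "z \<in> center P \<Longrightarrow> z \<in> carrier P"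
  by (simp add: centraliser_def)

lemma center_subset_centraliser: "Q \<subseteq> carrier P \<Longrightarrow> center P \<subseteq> centraliser P Q"
  unfolding centraliser_def by blast

lemma centraliser_eq_carrier:
  assumes "Q \<subseteq> center P"
  shows "centraliser P Q = carrier P"
proof -
  have "c \<otimes> x = x \<otimes> c" if "c \<in> carrier P" "x \<in> Q" for c x
    using center_commute[of x c] assms that by auto
  then show ?thesis unfolding centraliser_def by blast
qed

lemma subgroup_center: "subgroup (center P) P"
  using subgroup_centraliser[of "carrier P"] by simp

text \<open>The quotient by the centre is abelian. This is the form in which the class-two property
  enters all later arguments.\<close>

lemma commute_up_to_center:
  assumes x: "x \<in> carrier P" and y: "y \<in> carrier P"
  shows "\<exists>z\<in>center P. x \<otimes> y = z \<otimes> (y \<otimes> x)"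
proof -
  have "x \<otimes> z \<otimes> inv x \<in> center P" if "x \<in> carrier P" "z \<in> center P" for x z
  proof -
    have "x \<otimes> z \<otimes> inv x = z \<otimes> x \<otimes> inv x" using center_commute[OF that(2,1)] by simp
    then show ?thesis using that center_carrier[OF that(2)] by (simp add: m_assoc)
  qed
  then interpret Z: normal "center P" P
    using normal_inv_iff subgroup_center by blast
  interpret Mod: comm_group "P Mod center P"
    using extraspecial by (simp add: extraspecial_def elementary_abelian_def)
  have "center P #> (x \<otimes> y) = center P #> (y \<otimes> x)"
    using Mod.m_comm[of "center P #> x" "center P #> y"] x y Z.rcos_sum
    by (simp add: carrier_FactGroup)
  then have "x \<otimes> y \<in> center P #> (y \<otimes> x)"
    using rcos_self[OF _ subgroup_center, of "x \<otimes> y"] x y by simp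
  then show ?thesis by (auto simp: r_coset_def)
qed

lemma conj_by_up_to_center:
  assumes g: "g \<in> carrier P" and x: "x \<in> carrier P"
  shows "\<exists>z\<in>center P. conj_by P g x = z \<otimes> x"
proof -
  obtain z where z: "z \<in> center P" "x \<otimes> g = z \<otimes> (g \<otimes> x)" using commute_up_to_center[OF x g] by blast
  have zP: "z \<in> carrier P" using center_carrier[OF z(1)] .
  have "conj_by P g x = inv g \<otimes> (z \<otimes> (g \<otimes> x))"
    using z(2) g x by (simp add: conj_by_def m_assoc)
  also have "\<dots> = inv g \<otimes> g \<otimes> z \<otimes> x"
    using center_commute[OF z(1) g] g x zP by (simp add: m_assoc[symmetric])
  also have "\<dots> = z \<otimes> x" using g x zP by simp
  finally show ?thesis using z(1) by blast
qed

text \<open>Conjugation by g multiplies a by a central z and fixes z. In the quadratic word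
  \<open>inv z\<close> and z occur twice each, and everything cancels.\<close>

lemma conj_by_quadratic:
  assumes g: "g \<in> carrier P" and a: "a \<in> carrier P"
  shows "conj_by P g (inv a) \<otimes> a \<otimes> conj_by P g (inv a) \<otimes> conj_by P g (conj_by P g a) = \<one>"
proof -
  obtain z where z: "z \<in> center P" "conj_by P g a = z \<otimes> a"
    using conj_by_up_to_center[OF g a] by blast
  have zP: "z \<in> carrier P" using center_carrier[OF z(1)] .
  have comm: "z \<otimes> x = x \<otimes> z" if "x \<in> carrier P" for x using center_commute[OF z(1) that] .
  have "conj_by P g (inv a) \<otimes> conj_by P g a = \<one>"
    using conj_by_mult[of g "inv a" a] g a by (simp add: conj_by_def)
  then have "conj_by P g (inv a) = inv (z \<otimes> a)"
    using inv_equality[of "conj_by P g (inv a)" "z \<otimes> a"] g a zP z(2) by simp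
  then have inv: "conj_by P g (inv a) = inv a \<otimes> inv z"
    using a zP by (simp add: inv_mult_group)
  have "conj_by P g z = z"
    using conj_by_eq_self_iff[OF g zP] comm[OF g] by simp
  then have "conj_by P g (conj_by P g a) = z \<otimes> (z \<otimes> a)"
    using conj_by_mult[OF g zP a] z(2) by simp
  then have "conj_by P g (inv a) \<otimes> a \<otimes> conj_by P g (inv a) \<otimes> conj_by P g (conj_by P g a)
      = \<one>"
    using inv a zP by (simp add: m_assoc mult_inv_cancel_left)
  then show ?thesis .
qed

lemma card_subgroup_power:
  assumes "subgroup H P"
  shows "\<exists>i\<le>3. card H = p ^ i"
  using card_subgroup_dvd[OF assms subgroup_self subgroup.subset[OF assms]] order_eq
    divides_primepow_nat[OF prime_p] by (simp add: order_def)

lemma card_subgroup_cases: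
  assumes "subgroup H P" "p < card H"
  shows "card H = p\<^sup>2 \<or> H = carrier P"
proof -
  obtain i where i: "i \<le> 3" "card H = p ^ i" using card_subgroup_power[OF assms(1)] by blast
  have "\<not> i \<le> 1"
    using assms(2) i p_gt_1 power_increasing[of i 1 p] by auto
  then have "i = 2 \<or> i = 3" using i(1) by auto
  moreover have "H = carrier P" if "i = 3"
    using card_subset_eq[OF fin subgroup.subset[OF assms(1)]] i that order_eq by (simp add: order_def)
  ultimately show ?thesis using i by auto
qed

lemma card_centraliser_le:
  assumes Q: "Q \<subseteq> carrier P" "\<not> Q \<subseteq> center P"
  shows "card (centraliser P Q) \<le> p\<^sup>2"
proof (rule ccontr)
  have C: "subgroup (centraliser P Q) P" using subgroup_centraliser[OF Q(1)] .
  assume *: "\<not> card (centraliser P Q) \<le> p\<^sup>2"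
  then have "p < card (centraliser P Q)"
    using p_gt_1 power_increasing[of 1 2 p] by simp
  then have "centraliser P Q = carrier P" using card_subgroup_cases[OF C] * by auto
  then have "u \<otimes> x = x \<otimes> u" if "x \<in> Q" "u \<in> carrier P" for x u
    using that unfolding centraliser_def by blast
  then have "Q \<subseteq> center P" using Q(1) by (auto simp: centraliser_def)
  then show False using Q(2) by blast
qed

text \<open>Otherwise the centre Z, of prime order, meets Q trivially. Commutators of elements of Q
  lie in both, so Q is abelian; and ZQ has p^3 elements, so P = ZQ. Then Q is central, although it
  has more than p elements.\<close>

lemma centre_subset_if_card_square:
  assumes Q: "subgroup Q P" "card Q = p\<^sup>2"
  shows "center P \<subseteq> Q"
proof (rule ccontr)
  assume *: "\<not> center P \<subseteq> Q"
  have ZQ: "subgroup (center P \<inter> Q) P" using subgroups_Inter_pair[OF subgroup_center Q(1)] .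
  have "finite (center P)" using card_center p_gt_1 card.infinite by fastforce
  then have "card (center P \<inter> Q) < p"
    using * psubset_card_mono[of "center P" "center P \<inter> Q"] card_center by auto
  moreover have "card (center P \<inter> Q) dvd p"
    using card_subgroup_dvd[OF ZQ subgroup_center] card_center by simp
  ultimately have "card (center P \<inter> Q) = 1"
    using prime_p by (auto simp: prime_nat_iff)
  then have triv: "center P \<inter> Q = {\<one>}"
    using subgroup.one_closed[OF ZQ] by (metis card_1_singletonE singletonD)
  have QP: "x \<in> carrier P" if "x \<in> Q" for x using subgroup.mem_carrier[OF Q(1) that] .
  have comm: "x \<otimes> y = y \<otimes> x" if xy: "x \<in> Q" "y \<in> Q" for x y
  proof -
    obtain z where z: "z \<in> center P" "x \<otimes> y = z \<otimes> (y \<otimes> x)"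
      using commute_up_to_center QP xy by blast
    have "z = x \<otimes> y \<otimes> inv (y \<otimes> x)"
      using z QP xy center_carrier by (simp add: inv_solve_right)
    then have "z \<in> Q" using Q(1) xy by (simp add: subgroup.m_closed subgroup.m_inv_closed)
    then have "z = \<one>" using z(1) triv by blast
    then show ?thesis using z(2) QP xy by simp
  qed
  have "inj_on (\<lambda>(z, x). z \<otimes> x) (center P \<times> Q)"
  proof (intro inj_onI, clarsimp)
    fix z x z' x' assume a: "z \<in> center P" "x \<in> Q" "z' \<in> center P" "x' \<in> Q" "z \<otimes> x = z' \<otimes> x'"
    have "inv z' \<otimes> z = x' \<otimes> inv x"
      using a QP center_carrier by (metis inv_closed inv_solve_left inv_solve_right m_assoc m_closed)
    moreover have "inv z' \<otimes> z \<in> center P"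
      using a subgroup_center by (simp add: subgroup.m_closed subgroup.m_inv_closed)
    moreover have "x' \<otimes> inv x \<in> Q"
      using a Q(1) by (simp add: subgroup.m_closed subgroup.m_inv_closed)
    ultimately have "inv z' \<otimes> z = \<one>" "x' \<otimes> inv x = \<one>" using triv by auto
    then show "z = z' \<and> x = x'"
      using a QP center_carrier by (metis inv_equality inv_closed inv_inv inv_comm)
  qed
  then have "card ((\<lambda>(z, x). z \<otimes> x) ` (center P \<times> Q)) = p ^ 3"
    using card_center Q(2) by (simp add: card_image card_cartesian_product power3_eq_cube power2_eq_square)
  moreover have "(\<lambda>(z, x). z \<otimes> x) ` (center P \<times> Q) \<subseteq> carrier P"
    using QP center_carrier by auto
  ultimately have P_eq: "(\<lambda>(z, x). z \<otimes> x) ` (center P \<times> Q) = carrier P"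
    using card_subset_eq[OF fin] order_eq by (simp add: order_def)
  have "Q \<subseteq> center P"
  proof
    fix x assume x: "x \<in> Q"
    have "x \<otimes> u = u \<otimes> x" if u: "u \<in> carrier P" for u
    proof -
      have "u \<in> (\<lambda>(z, x). z \<otimes> x) ` (center P \<times> Q)" using u P_eq by simp
      then obtain z y where zy: "z \<in> center P" "y \<in> Q" "u = z \<otimes> y" by auto
      have cs: "z \<in> carrier P" "y \<in> carrier P" "x \<in> carrier P"
        using zy x QP center_carrier by auto
      have "x \<otimes> u = z \<otimes> (x \<otimes> y)"
        using center_commute[OF zy(1) cs(3)] cs zy(3) by (simp add: m_assoc[symmetric])
      then show ?thesis using comm[OF x zy(2)] cs zy(3) by (simp add: m_assoc)
    qed
    then show "x \<in> center P" using QP[OF x] by (simp add: centraliser_def)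
  qed
  then have "card Q \<le> p"
    using card_mono[of "center P" Q] \<open>finite (center P)\<close> card_center by simp
  then show False using Q(2) p_gt_1 by (simp add: power2_eq_square)
qed

text \<open>Conjugation changes elements only by central factors, and these lie in Q.\<close>

lemma normalizer_eq_carrier_if_card_square:
  assumes Q: "subgroup Q P" "card Q = p\<^sup>2"
  shows "normalizer P Q = carrier P"
proof -
  have QP: "Q \<subseteq> carrier P" using subgroup.subset[OF Q(1)] .
  have "conj_by P g ` Q = Q" if g: "g \<in> carrier P" for g
  proof -
    have "conj_by P g ` Q \<subseteq> Q"
    proof (rule image_subsetI)
      fix x assume x: "x \<in> Q"
      then obtain z where "z \<in> center P" "conj_by P g x = z \<otimes> x"
        using conj_by_up_to_center[OF g] QP by blast
      then show "conj_by P g x \<in> Q"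
        using centre_subset_if_card_square[OF Q] subgroup.m_closed[OF Q(1) _ x] by auto
    qed
    moreover have "inj_on (conj_by P g) Q"
    proof (rule inj_on_inverseI[where g = "conj_by P (inv g)"])
      show "conj_by P (inv g) (conj_by P g x) = x" if "x \<in> Q" for x
        using that g QP by (auto simp: conj_by_conj_by)
    qed
    ultimately show ?thesis
      using endo_inj_surj[of Q "conj_by P g"] finite_subset[OF QP fin] by blast
  qed
  then show ?thesis using mem_normalizer_iff[OF QP] by blast
qed

text \<open>For a noncentral g in Q, the centraliser of g in Q contains g and the centre, so it has
  more than p elements and is Q. Hence Q is abelian and lies in its centraliser; equality follows
  from the bound p^2 for noncentral subgroups.\<close>

lemma centraliser_eq_if_card_square:
  assumes Q: "subgroup Q P" "card Q = p\<^sup>2"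
  shows "centraliser P Q = Q"
proof -
  have QP: "Q \<subseteq> carrier P" using subgroup.subset[OF Q(1)] .
  have finQ: "finite Q" using finite_subset[OF QP fin] .
  have ZQ: "center P \<subseteq> Q" by (rule centre_subset_if_card_square[OF Q])
  have p_less: "p < p\<^sup>2" using p_gt_1 by (simp add: power2_eq_square)
  have "Q \<subseteq> centraliser P {g}" if g: "g \<in> Q" for g
  proof (cases "g \<in> center P")
    case True
    have "x \<otimes> g = g \<otimes> x" if "x \<in> Q" for x
      using center_commute[OF True, of x] that QP by auto
    then show ?thesis unfolding centraliser_def using QP by blast
  next
    case False
    have C: "subgroup (centraliser P {g} \<inter> Q) P"
      using subgroups_Inter_pair[OF subgroup_centraliser Q(1)] g QP by blast
    have "insert g (center P) \<subseteq> centraliser P {g} \<inter> Q"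
      using g QP ZQ center_subset_centraliser[of "{g}"] by (auto simp: centraliser_def[of _ "{g}"])
    then have "card (insert g (center P)) \<le> card (centraliser P {g} \<inter> Q)"
      using finQ by (intro card_mono) auto
    then have "p < card (centraliser P {g} \<inter> Q)"
      using False finite_subset[OF ZQ finQ] card_center by simp
    moreover have "card (centraliser P {g} \<inter> Q) \<le> p\<^sup>2"
      using card_mono[OF finQ, of "centraliser P {g} \<inter> Q"] Q(2) by simp
    ultimately have "card (centraliser P {g} \<inter> Q) = card Q"
      using card_subgroup_cases[OF C] Q(2) fin order_eq
      by (metis Int_lower2 QP card_mono card_subset_eq order_antisym finQ)
    then show ?thesis using card_subset_eq[OF finQ, of "centraliser P {g} \<inter> Q"] by blast
  qed
  then have "Q \<subseteq> centraliser P Q" unfolding centraliser_def by blast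
  moreover have "\<not> Q \<subseteq> center P"
    using card_mono[of "center P" Q] finite_subset[OF ZQ finQ] card_center Q(2) p_less by auto
  then have "card (centraliser P Q) \<le> card Q"
    using card_centraliser_le[OF QP] Q(2) by simp
  moreover have "finite (centraliser P Q)"
    using finite_subset[OF _ fin] by (auto simp: centraliser_def)
  ultimately show ?thesis by (metis card_seteq)
qed

text \<open>In the noncentral case Q has order p, so each nontrivial x in Q has centraliser Q within
  Q, and Q is abelian. The centraliser of Q then contains the centre and a further element of
  Q.\<close>

lemma card_centraliser_gt:
  assumes Q: "subgroup Q P" "card Q \<le> p"
  shows "p < card (centraliser P Q)"
proof (cases "Q \<subseteq> center P")
  case True
  then have "centraliser P Q = carrier P" by (rule centraliser_eq_carrier)
  then show ?thesis
    using order_eq p_gt_1 power_strict_increasing[of 1 3 p] by (simp add: order_def)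
next
  case False
  have QP: "Q \<subseteq> carrier P" using subgroup.subset[OF Q(1)] .
  have finQ: "finite Q" using finite_subset[OF QP fin] .
  obtain g where g: "g \<in> Q" "g \<notin> center P" using False by blast
  have card_ge: "card H = p" if H: "subgroup H P" "H \<subseteq> Q" "h \<in> H" "h \<noteq> \<one>" for H h
  proof -
    have "card {\<one>, h} \<le> card H"
      using H subgroup.one_closed[OF H(1)] finite_subset[OF H(2) finQ] by (intro card_mono) auto
    then have "2 \<le> card H" using H(4) by simp
    moreover have "card H \<le> p" using card_mono[OF finQ H(2)] Q(2) by simp
    moreover obtain i where "card H = p ^ i" using card_subgroup_power[OF H(1)] by blast
    ultimately have "i = 1"
      using p_gt_1 power_increasing_iff[of p i 1] by (cases i) auto
    then show ?thesis using \<open>card H = p ^ i\<close> by simp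
  qed
  have "Q \<subseteq> centraliser P {x}" if x: "x \<in> Q" for x
  proof (cases "x = \<one>")
    case True
    then show ?thesis using QP by (auto simp: centraliser_def)
  next
    case False
    have C: "subgroup (centraliser P {x} \<inter> Q) P"
      using subgroups_Inter_pair[OF subgroup_centraliser Q(1)] x QP by blast
    have "x \<in> centraliser P {x} \<inter> Q" using x QP by (auto simp: centraliser_def)
    then have "card (centraliser P {x} \<inter> Q) = card Q"
      using card_ge[OF C _ _ False] card_ge[OF Q(1) _ x False] by simp
    then show ?thesis using card_subset_eq[OF finQ, of "centraliser P {x} \<inter> Q"] by blast
  qed
  then have "Q \<subseteq> centraliser P Q" unfolding centraliser_def by blast
  then have "insert g (center P) \<subseteq> centraliser P Q"
    using g center_subset_centraliser[OF QP] by blast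
  then have "card (insert g (center P)) \<le> card (centraliser P Q)"
    using finite_subset[OF _ fin, of "centraliser P Q"] by (intro card_mono) (auto simp: centraliser_def)
  moreover have "finite (center P)" using card_center p_gt_1 card.infinite by fastforce
  ultimately show ?thesis using g(2) card_center by simp
qed

end

section \<open>Saturated p-stable fusion systems on P\<close>

locale saturated_extraspecial_cubed = extraspecial_cubed P p + saturated_fusion_system P F p
  for P :: "('a, 'b) monoid_scheme" (structure) and p F
begin

lemma fully_normalised_if_normalizer_eq:
  assumes "subgroup Q P" "normalizer P Q = carrier P"
  shows "fully_normalised P F Q"
  using assms card_mono[OF fin normalizer_subset] by (simp add: fully_normalised_def)

lemma conj_by_mem_F_self:
  assumes Q: "subgroup Q P" and g: "g \<in> normalizer P Q"
  shows "restrict (conj_by P g) Q \<in> F Q Q"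
proof -
  have "g \<in> carrier P" "conj_by P g ` Q \<subseteq> Q"
    using g mem_normalizer_iff[OF subgroup.subset[OF Q]] by auto
  then have "restrict (conj_by P g) Q \<in> conj_fusion P Q Q" by (auto simp: conj_fusion_def)
  then show ?thesis using conj_morphisms[OF Q Q] by blast
qed

context
  assumes stable: "p_stable p P F"
begin

text \<open>By \<open>p\<close>-stability, \<open>Aut_P(Q)\<close>, which has order \<open>p\<close>, lies in the largest normal \<open>p\<close>-subgroup
  of \<open>Aut_F(Q)\<close>, so that it is the unique Sylow \<open>p\<close>-subgroup.\<close>

lemma p_element_is_conj:
  assumes Q: "subgroup Q P" "card Q = p\<^sup>2" and b: "b \<in> F Q Q"
    and b_pow: "b [^]\<^bsub>BijGroup Q\<^esub> (p ^ k) = \<one>\<^bsub>BijGroup Q\<^esub>"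
  shows "\<exists>h\<in>carrier P. b = restrict (conj_by P h) Q"
proof -
  have QP: "Q \<subseteq> carrier P" using subgroup.subset[OF Q(1)] .
  have norm: "normalizer P Q = carrier P" using normalizer_eq_carrier_if_card_square[OF Q] .
  have conj_Q: "conj_by P g x \<in> Q" if "g \<in> carrier P" "x \<in> Q" for g x
    using mem_normalizer_iff[OF QP, of g] norm that by blast
  have fn: "fully_normalised P F Q" using fully_normalised_if_normalizer_eq[OF Q(1) norm] .
  define A where "A = Aut_grp F Q"
  define S where "S = conj_fusion P Q Q"
  have sylow: "sylow_subgroup p A S" using sylow_axiom[OF fn] by (simp add: A_def S_def)
  have A_sub: "subgroup (F Q Q) (BijGroup Q)" using subgroup_F_self[OF fin Q(1)] .
  interpret A: group A
    unfolding A_def Aut_grp_def by (rule group.subgroup_imp_group[OF group_BijGroup A_sub])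
  have A_car: "carrier A = F Q Q" by (simp add: A_def Aut_grp_def)
  have S_eq: "S = (\<lambda>g. restrict (conj_by P g) Q) ` carrier P"
    using conj_Q by (auto simp: S_def conj_fusion_def)
  have S_core: "S \<subseteq> p_core p A"
  proof
    fix \<chi> assume "\<chi> \<in> S"
    then obtain g where g: "g \<in> carrier P" "\<chi> = restrict (conj_by P g) Q" using S_eq by blast
    have "\<forall>a\<in>Q. \<chi> (inv a) \<otimes> a \<otimes> \<chi> (inv a) \<otimes> \<chi> (\<chi> a) = \<one>"
    proof
      fix a assume a: "a \<in> Q"
      then show "\<chi> (inv a) \<otimes> a \<otimes> \<chi> (inv a) \<otimes> \<chi> (\<chi> a) = \<one>"
        using conj_by_quadratic[OF g(1), of a] QP subgroup.m_inv_closed[OF Q(1) a] conj_Q[OF g(1) a]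
        by (auto simp: g(2))
    qed
    moreover have "\<chi> \<in> F Q Q" using conj_by_mem_F_self[OF Q(1)] norm g by simp
    ultimately show "\<chi> \<in> p_core p A"
      using stable fn by (simp add: p_stable_def A_def)
  qed
  have S_card: "card S = p"
  proof -
    \<comment> \<open>The inverse makes conjugation a homomorphism into \<open>BijGroup\<close>. Its
      image is S and its kernel the centraliser of Q, which is Q, so S has order p^3 / p^2.\<close>
    let ?\<theta> = "\<lambda>g. restrict (conj_by P (inv g)) Q"
    have "group_hom (P\<lparr>carrier := carrier P\<rparr>) (BijGroup Q) ?\<theta>"
      using conj_Q QP
      by (intro action_hom_BijGroup subgroup_self)
        (auto simp: conj_by_conj_by inv_mult_group subset_iff)
    then interpret \<theta>: group_hom P "BijGroup Q" ?\<theta> by simp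
    have "?\<theta> ` carrier P = S"
    proof
      show "?\<theta> ` carrier P \<subseteq> S" using S_eq by auto
      show "S \<subseteq> ?\<theta> ` carrier P"
        unfolding S_eq by (auto intro!: image_eqI[of _ _ "inv _"])
    qed
    moreover have "kernel P (BijGroup Q) ?\<theta> = centraliser P Q"
    proof -
      have "?\<theta> g = \<one>\<^bsub>BijGroup Q\<^esub> \<longleftrightarrow> (\<forall>x\<in>Q. g \<otimes> x = x \<otimes> g)" if g: "g \<in> carrier P" for g
      proof -
        have "?\<theta> g = \<one>\<^bsub>BijGroup Q\<^esub> \<longleftrightarrow> (\<forall>x\<in>Q. conj_by P (inv g) x = x)"
          by (auto simp: BijGroup_def fun_eq_iff restrict_def)
        also have "\<dots> \<longleftrightarrow> (\<forall>x\<in>Q. conj_by P g x = x)"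
        proof -
          have "conj_by P (inv g) (conj_by P g x) = x" "conj_by P g (conj_by P (inv g) x) = x" if "x \<in> Q" for x
            using that g QP by (auto simp: conj_by_conj_by)
          then show ?thesis by metis
        qed
        also have "\<dots> \<longleftrightarrow> (\<forall>x\<in>Q. g \<otimes> x = x \<otimes> g)"
          using conj_by_eq_self_iff[OF g] QP by (metis subsetD)
        finally show ?thesis .
      qed
      then show ?thesis unfolding kernel_def centraliser_def by blast
    qed
    ultimately have "card S * p\<^sup>2 = p ^ 3"
      using \<theta>.card_image_kernel centraliser_eq_if_card_square[OF Q] Q(2) order_eq by simp
    then show ?thesis using p_gt_1 by (simp add: power2_eq_square power3_eq_cube)
  qed
  have S_sub: "subgroup S A" and S_mult: "card S = p ^ multiplicity p (order A)"
    using sylow by (auto simp: sylow_subgroup_def)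
  have A_fin: "finite (carrier A)"
  proof -
    have "F Q Q \<subseteq> Q \<rightarrow>\<^sub>E Q"
      using F_closed[OF Q(1,1)] F_hom(3)[OF Q(1,1)] by (auto simp: PiE_def extensional_def)
    then show ?thesis
      using finite_subset[OF _ finite_PiE[of Q "\<lambda>_. Q"]] finite_subset[OF QP fin] A_car by auto
  qed
  have finS: "finite S" using finite_subset[OF subgroup.subset[OF S_sub] A_fin] .
  have "S \<lhd> A"
  proof -
    \<comment> \<open>Since \<open>p_core\<close> is a union, one nontrivial s in S already selects
      a normal p-subgroup N. As |S| = p, the intersection of N and S is S; as S is Sylow, |N| is at
      most p, so N = S.\<close>
    obtain s where s: "s \<in> S" "s \<noteq> \<one>\<^bsub>A\<^esub>"
    proof -
      have "\<not> S \<subseteq> {\<one>\<^bsub>A\<^esub>}"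
        using S_card p_gt_1 card_mono[of "{\<one>\<^bsub>A\<^esub>}" S] by auto
      then show thesis using that by blast
    qed
    obtain N where N: "N \<lhd> A" "finite_p_group p (A\<lparr>carrier := N\<rparr>)" "s \<in> N"
      using s(1) S_core by (auto simp: p_core_def)
    have N_sub: "subgroup N A" using N(1) normal_imp_subgroup by blast
    obtain i where i: "card N = p ^ i" using N(2) by (auto simp: finite_p_group_def order_def)
    have finN: "finite N" using finite_subset[OF subgroup.subset[OF N_sub] A_fin] .
    have "p ^ i dvd order A"
      using A.card_subgroup_dvd[OF N_sub A.subgroup_self subgroup.subset[OF N_sub]] i
      by (simp add: order_def)
    then have "i \<le> multiplicity p (order A)"
      using power_dvd_iff_le_multiplicity[of "order A" p i] A_fin A.order_gt_0_iff_finite p_gt_1 by auto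
    then have N_le: "card N \<le> p"
      using S_mult S_card i p_gt_1 power_increasing[of i "multiplicity p (order A)" p] by simp
    have NS: "subgroup (N \<inter> S) A" using A.subgroups_Inter_pair[OF N_sub S_sub] .
    have "card {\<one>\<^bsub>A\<^esub>, s} \<le> card (N \<inter> S)"
      using s N(3) subgroup.one_closed[OF NS] finS by (intro card_mono) auto
    then have "card (N \<inter> S) \<noteq> 1" using s(2) by simp
    moreover have "card (N \<inter> S) dvd p"
      using A.card_subgroup_dvd[OF NS S_sub] S_card by simp
    ultimately have "card (N \<inter> S) = card S" using prime_p S_card by (auto simp: prime_nat_iff)
    then have "N \<inter> S = S" using card_subset_eq[OF finS, of "N \<inter> S"] by blast
    then have "S = N"
      using card_seteq[OF finN, of S] N_le S_card by blast
    then show ?thesis using N(1) by simp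
  qed
  then interpret S: normal S A .
  have bA: "b \<in> carrier A" using b A_car by simp
  have "coprime (order (A Mod S)) (p ^ k)"
    using prime_imp_coprime[OF prime_p A.sylow_index_not_dvd[OF prime_p A_fin sylow]]
    by (simp add: coprime_commute)
  moreover have "b [^]\<^bsub>A\<^esub> (p ^ k) \<in> S"
    using b_pow monoid.nat_pow_consistent[OF group.is_monoid[OF group_BijGroup[of Q]], of b "p ^ k" "F Q Q"] S.one_closed
    by (simp add: A_def Aut_grp_def)
  ultimately have "b \<in> S"
    using A.mem_subgroup_if_coprime_powers[OF S_sub bA S.pow_order_Mod_mem[OF A_fin bA]] by blast
  then show ?thesis using S_eq by blast
qed

text \<open>Transporting conjugation by g to the image R of \<phi> gives a p-element of Aut_F(R),
  which is conjugation by some h in P. This h witnesses that g lies in the extender, so the extender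
  is P. The image is normal in P, hence fully normalised and fully centralised.\<close>

lemma extends_if_card_square:
  assumes Q: "subgroup Q P" "card Q = p\<^sup>2" and \<phi>: "\<phi> \<in> F Q (carrier P)"
  shows "\<exists>\<beta>\<in>F (carrier P) (carrier P). \<forall>x\<in>Q. \<phi> x = \<beta> x"
proof -
  define R where "R = \<phi> ` Q"
  have QP: "Q \<subseteq> carrier P" using subgroup.subset[OF Q(1)] .
  have inj: "inj_on \<phi> Q" using F_hom(2)[OF Q(1) subgroup_self \<phi>] .
  have R: "subgroup R P" "card R = p\<^sup>2"
    using subgroup_F_image[OF Q(1) subgroup_self \<phi>] card_image[OF inj] Q(2) by (auto simp: R_def)
  have RP: "R \<subseteq> carrier P" using subgroup.subset[OF R(1)] .
  have norm: "normalizer P Q = carrier P" "normalizer P R = carrier P"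
    using normalizer_eq_carrier_if_card_square Q R by auto
  have \<phi>R: "\<phi> \<in> F Q R" and inv_\<phi>: "restrict (inv_into Q \<phi>) R \<in> F R Q"
    using iso_onto_image[OF Q(1) subgroup_self \<phi>] by (auto simp: R_def)
  have "g \<in> extender P Q \<phi>" if g: "g \<in> carrier P" for g
  proof -
    \<comment> \<open>This is \<phi> c_g \<phi>^-1 on R.\<close>
    define b where "b = compose R (compose Q \<phi> (restrict (conj_by P g) Q)) (restrict (inv_into Q \<phi>) R)"
    have conj_Q: "conj_by P g x \<in> Q" if "g \<in> carrier P" "x \<in> Q" for g x
      using mem_normalizer_iff[OF QP, of g] norm that by blast
    have b: "b \<in> F R R"
      unfolding b_def
      using compose_morphisms[OF Q(1,1) R(1) conj_by_mem_F_self[OF Q(1)] \<phi>R] norm(1) g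
      by (intro compose_morphisms[OF R(1) Q(1) R(1) inv_\<phi>]) simp
    have b_apply: "b (\<phi> x) = \<phi> (conj_by P g x)" if "x \<in> Q" for x
      using that inj by (simp add: b_def compose_def R_def)
    interpret B: group "BijGroup R" by (rule group_BijGroup)
    have F_sub: "subgroup (F R R) (BijGroup R)" using subgroup_F_self[OF fin R(1)] .
    have bB: "b \<in> carrier (BijGroup R)" using subgroup.mem_carrier[OF F_sub b] .
    have b_pow_F: "b [^]\<^bsub>BijGroup R\<^esub> n \<in> F R R" for n :: nat
      using monoid.nat_pow_closed[OF group.is_monoid[OF B.subgroup_imp_group[OF F_sub]], of b n] b
        B.nat_pow_consistent[of b n "F R R"] by simp
    have b_pow: "(b [^]\<^bsub>BijGroup R\<^esub> n) (\<phi> x) = \<phi> (conj_by P (g [^] n) x)" if x: "x \<in> Q" for n :: nat and x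
    proof (induction n)
      case 0
      have "\<phi> x \<in> R" using x by (simp add: R_def)
      then show ?case using x QP by (auto simp: BijGroup_def)
    next
      case (Suc n)
      have "\<phi> x \<in> R" using x by (simp add: R_def)
      then have "(b [^]\<^bsub>BijGroup R\<^esub> Suc n) (\<phi> x) = b ((b [^]\<^bsub>BijGroup R\<^esub> n) (\<phi> x))"
        using BijGroup_mult_apply[OF fin R(1) b b_pow_F[of n]] B.nat_pow_Suc2[OF bB, of n] by simp
      also have "\<dots> = \<phi> (conj_by P g (conj_by P (g [^] n) x))"
        using Suc b_apply conj_Q[of "g [^] n" x] x g by simp
      also have "conj_by P g (conj_by P (g [^] n) x) = conj_by P (g [^] Suc n) x"
        using g x QP by (auto simp: conj_by_conj_by)
      finally show ?case .
    qed
    \<comment> \<open>The exponent is |P|, which kills g and with it the transported map b.\<close>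
    have "b [^]\<^bsub>BijGroup R\<^esub> (p ^ 3) = \<one>\<^bsub>BijGroup R\<^esub>"
    proof (rule extensionalityI[where A = R])
      show "b [^]\<^bsub>BijGroup R\<^esub> p ^ 3 \<in> extensional R" using F_hom(3)[OF R(1,1) b_pow_F] .
      show "\<one>\<^bsub>BijGroup R\<^esub> \<in> extensional R" by (simp add: BijGroup_def)
      fix y assume "y \<in> R"
      then obtain x where x: "x \<in> Q" "y = \<phi> x" by (auto simp: R_def)
      have "g [^] (p ^ 3) = \<one>" using pow_order_eq_1[OF g] order_eq by simp
      then have "(b [^]\<^bsub>BijGroup R\<^esub> (p ^ 3)) y = y"
        using b_pow[OF x(1), of "p ^ 3"] x QP by auto
      then show "(b [^]\<^bsub>BijGroup R\<^esub> p ^ 3) y = \<one>\<^bsub>BijGroup R\<^esub> y"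
        using \<open>y \<in> R\<close> by (simp add: BijGroup_def)
    qed
    then obtain h where h: "h \<in> carrier P" "b = restrict (conj_by P h) R"
      using p_element_is_conj[OF R b] by blast
    have "\<phi> (conj_by P g x) = conj_by P h (\<phi> x)" if "x \<in> Q" for x
      using b_apply[OF that] h(2) that by (simp add: R_def)
    then show ?thesis using g h(1) norm by (auto simp: extender_def R_def)
  qed
  then have "extender P Q \<phi> = carrier P"
    using subgroup.subset[OF subgroup_extender[OF Q(1) subgroup_self \<phi>]] by blast
  moreover have "fully_centralised P F (\<phi> ` Q)"
    using sylow_axiom[OF fully_normalised_if_normalizer_eq[OF R(1) norm(2)]] by (simp add: R_def)
  ultimately obtain \<psi> where "\<psi> \<in> F (carrier P) (carrier P)" "\<forall>x\<in>Q. \<psi> x = \<phi> x"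
    using extension_axiom[OF Q(1) \<phi>] by auto
  then show ?thesis by (intro bexI[of _ \<psi>]) simp_all
qed

text \<open>The extender contains the centraliser of Q, which has more than p elements, so it has
  order p^2 or is P. The extension axiom reaches it, and \<open>extends_if_card_square\<close>
  covers the rest of the way.\<close>

lemma extends_if_fully_centralised:
  assumes Q: "subgroup Q P" "card Q \<le> p" and \<phi>: "\<phi> \<in> F Q (carrier P)"
    and fc: "fully_centralised P F (\<phi> ` Q)"
  shows "\<exists>\<beta>\<in>F (carrier P) (carrier P). \<forall>x\<in>Q. \<phi> x = \<beta> x"
proof -
  define E where "E = extender P Q \<phi>"
  have QP: "Q \<subseteq> carrier P" using subgroup.subset[OF Q(1)] .
  have E: "subgroup E P" using subgroup_extender[OF Q(1) subgroup_self \<phi>] by (simp add: E_def)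
  have C: "centraliser P Q \<subseteq> E"
    using centraliser_subset_extender[OF QP] F_closed[OF Q(1) subgroup_self \<phi>]
    by (auto simp: E_def)
  obtain \<psi> where \<psi>: "\<psi> \<in> F E (carrier P)" "\<forall>x\<in>Q. \<psi> x = \<phi> x"
    using extension_axiom[OF Q(1) \<phi> fc] by (auto simp: E_def)
  have "p < card E"
    using card_centraliser_gt[OF Q] card_mono[OF finite_subset[OF subgroup.subset[OF E] fin] C] by simp
  then consider "card E = p\<^sup>2" | "E = carrier P" using card_subgroup_cases[OF E] by blast
  then have "\<exists>\<beta>\<in>F (carrier P) (carrier P). \<forall>x\<in>E. \<psi> x = \<beta> x"
    using extends_if_card_square[OF E _ \<psi>(1)] \<psi>(1) by cases auto
  moreover have "Q \<subseteq> E"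
    using subset_extender[OF Q(1) subgroup_self \<phi>] by (simp add: E_def)
  ultimately show ?thesis using \<psi>(2) by (metis subsetD)
qed

text \<open>A central image has all of P as centraliser and is therefore fully centralised. The
  morphism would extend to an automorphism of P, and pulling back along it would make Q
  central.\<close>

lemma image_not_central:
  assumes Q: "subgroup Q P" "card Q \<le> p" "\<not> Q \<subseteq> center P" and \<phi>: "\<phi> \<in> F Q (carrier P)"
  shows "\<not> \<phi> ` Q \<subseteq> center P"
proof
  assume central: "\<phi> ` Q \<subseteq> center P"
  have "fully_centralised P F (\<phi> ` Q)"
    using centraliser_eq_carrier[OF central] subgroup_F_image[OF Q(1) subgroup_self \<phi>]
      card_mono[OF fin centraliser_subset]
    by (simp add: fully_centralised_def)
  then obtain \<beta> where \<beta>: "\<beta> \<in> F (carrier P) (carrier P)" "\<forall>x\<in>Q. \<phi> x = \<beta> x"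
    using extends_if_fully_centralised[OF Q(1,2) \<phi>] by blast
  have QP: "Q \<subseteq> carrier P" using subgroup.subset[OF Q(1)] .
  have \<beta>_surj: "\<beta> ` carrier P = carrier P" using F_self_image[OF fin subgroup_self \<beta>(1)] .
  have "x \<in> center P" if x: "x \<in> Q" for x
  proof -
    have "\<beta> x \<in> center P" using central \<beta>(2) x by force
    have "x \<otimes> y = y \<otimes> x" if y: "y \<in> carrier P" for y
    proof -
      have cs: "x \<in> carrier P" "\<beta> y \<in> carrier P"
        using x y QP F_closed[OF subgroup_self subgroup_self \<beta>(1)] by auto
      have "\<beta> (x \<otimes> y) = \<beta> (y \<otimes> x)"
        using F_mult[OF subgroup_self subgroup_self \<beta>(1)] cs y
          center_commute[OF \<open>\<beta> x \<in> center P\<close> cs(2)] by simp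
      then show ?thesis
        using F_hom(2)[OF subgroup_self subgroup_self \<beta>(1)] cs y by (auto simp: inj_on_def)
    qed
    then show ?thesis using x QP by (auto simp: centraliser_def)
  qed
  then show False using Q(3) by blast
qed

text \<open>For |Q| at most p it remains to see that the image R is fully centralised. If R is
  central, its centraliser is P. Otherwise its centraliser has order at least p^2, while every
  F-image of R is noncentral too, so that p^2 bounds the order of its centraliser.\<close>

theorem extends_to_P:
  assumes Q: "subgroup Q P" and \<phi>: "\<phi> \<in> F Q (carrier P)"
  shows "\<exists>\<beta>\<in>F (carrier P) (carrier P). \<forall>x\<in>Q. \<phi> x = \<beta> x"
proof (cases "p < card Q")
  case True
  then consider "card Q = p\<^sup>2" | "Q = carrier P" using card_subgroup_cases[OF Q] by blast
  then show ?thesis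
    using extends_if_card_square[OF Q _ \<phi>] \<phi> by cases auto
next
  case False
  define R where "R = \<phi> ` Q"
  have R: "subgroup R P" using subgroup_F_image[OF Q subgroup_self \<phi>] by (simp add: R_def)
  have R_card: "card R \<le> p"
    using False card_image_le[OF finite_subset[OF subgroup.subset[OF Q] fin], of \<phi>] by (simp add: R_def)
  have "card (centraliser P (\<psi> ` R)) \<le> card (centraliser P R)"
    if T: "subgroup T P" and \<psi>: "\<psi> \<in> F R T" for T \<psi>
  proof (cases "R \<subseteq> center P")
    case True
    then show ?thesis
      using centraliser_eq_carrier[OF True] card_mono[OF fin centraliser_subset] by simp
  next
    case False
    have \<psi>P: "\<psi> \<in> F R (carrier P)"
      using F_codomain[OF R T subgroup_self \<psi>] F_closed[OF R T \<psi>] subgroup.mem_carrier[OF T] by blast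
    have "card (centraliser P (\<psi> ` R)) \<le> p\<^sup>2"
      using card_centraliser_le[OF subgroup.subset[OF subgroup_F_image[OF R subgroup_self \<psi>P]]
          image_not_central[OF R R_card False \<psi>P]] .
    moreover have "p\<^sup>2 \<le> card (centraliser P R)"
    proof -
      have "card (carrier P) = p ^ 3" using order_eq by (simp add: order_def)
      then show ?thesis
        using card_subgroup_cases[OF subgroup_centraliser[OF subgroup.subset[OF R]]
            card_centraliser_gt[OF R R_card]] p_gt_1 power_increasing[of 2 3 p] by auto
    qed
    ultimately show ?thesis by simp
  qed
  then have "fully_centralised P F (\<phi> ` Q)"
    using R by (simp add: fully_centralised_def R_def)
  then show ?thesis using extends_if_fully_centralised[OF Q _ \<phi>] False by simp
qed

text \<open>P is its own normaliser and thus fully normalised, so the Sylow axiom makes the inner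
  automorphisms a Sylow subgroup of Aut_F(P).\<close>

theorem semidirect_fusion: "semidirect_fusion p P F"
proof (rule semidirect_fusion_if_extends[OF prime_p p_group])
  have "normalizer P (carrier P) = carrier P"
    using normal_in_normalizer[OF subgroup_self] normal_imp_subgroup subgroup.subset normalizer_subset[of P "carrier P"]
    by fastforce
  then show "sylow_subgroup p (Aut_grp F (carrier P)) (conj_fusion P (carrier P) (carrier P))"
    using sylow_axiom fully_normalised_if_normalizer_eq[OF subgroup_self] by blast
qed (use commute_up_to_center extends_to_P in auto)

end

end

theorem proposition10p1:
  fixes p :: nat and P :: "('a, 'b) monoid_scheme"
  assumes "Factorial_Ring.prime p" and "odd p"
    and "extraspecial p P" and "order P = p ^ 3" and "group_exponent P = p"
  shows "(\<forall>F. saturated_fusion_system P F p \<longrightarrow> \<not> semidirect_fusion p P F \<longrightarrow> \<not> p_stable p P F) \<and>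
    (\<forall>F (G :: ('g, 'c) monoid_scheme) S H \<iota>. realised_by p P F G S H \<iota> \<longrightarrow>
       p_stable p P F \<and> section_p_stable p P F)"
proof (intro conjI allI impI notI)
  fix F
  assume "saturated_fusion_system P F p" "\<not> semidirect_fusion p P F" "p_stable p P F"
  moreover have "group P" using assms(3) by (simp add: extraspecial_def finite_p_group_def)
  ultimately show False
    using assms saturated_extraspecial_cubed.semidirect_fusion[of P p F]
    by (simp add: saturated_extraspecial_cubed_def extraspecial_cubed_def extraspecial_cubed_axioms_def)
next
  fix F and G :: "('g, 'c) monoid_scheme" and S H \<iota>
  assume "realised_by p P F G S H \<iota>"
  moreover have "finite_p_group p P" using assms(3) by (simp add: extraspecial_def)
  ultimately show "p_stable p P F" "section_p_stable p P F"
    using p_stable_if_realised_by[OF assms(1)] by blast+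
qed

end
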